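(* Let $A,B,Q$ be real numbers and let either $$N=2,\qquad 2\le Q,\qquad B=A-\frac2Q,$$ or else $$N\ge3,\qquad 2\le Q\le\frac{2N}{N-2},\qquad B=A-1+\frac{Q-2}{2Q}N.$$ Suppose that $BQ+2A\ne0$ or that $A=B=0$. Then: (i) There exists a positive constant $C=C(A,Q,N)$ such that for every $f\in C_0^\infty(\mathbb R^N_+)$ $$\left(\int_{\mathbb R^N_+}x_N^{BQ}|f(x',x_N)|^Q\,dx'\,dx_N\right)^{\frac2Q}\le C\int_{\mathbb R^N_+}x_N^{2A}\left(|\nabla_{x'}f|^2+|\partial_{x_N}f|^2\right)dx'\,dx_N.$$ (ii) If moreover $BQ+2A>0$, or if $A=B=0$, the same inequality still holds (with integrals over $\mathbb R^N_+$) for every $f\in C_0^\infty(\mathbb R^N)$.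
   Context: $\mathbb R^N_+:=\{(x',x_N)\in\mathbb R^{N-1}\times\mathbb R:x_N>0\}$. $C_0^\infty(U)$ denotes the smooth real-valued functions with compact support in the open set $U$. $\nabla_{x'}$ is the gradient in the $x'$ variables. The right-hand side may be $+\infty$ in part (ii), in which case the inequality is trivially true. *)

theory Defs
  imports "HOL-Analysis.Analysis"
begin

text \<open>Points of \<open>\<real>\<^sup>N\<close> are pairs \<open>(x', t)\<close> in \<open>(real ^ 'n) \<times> real\<close>, where \<open>t\<close> is the last
  coordinate and \<open>N = CARD('n) + 1\<close>.\<close>

definition half_space :: "('a \<times> real) set" where
  "half_space = {(x', t). 0 < t}"

text \<open>\<open>Ck_on k U f\<close>: on the open set \<open>U\<close>, \<open>f\<close> is \<open>k\<close> times continuously differentiable.\<close>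

primrec Ck_on :: "nat \<Rightarrow> 'a::real_normed_vector set \<Rightarrow> ('a \<Rightarrow> real) \<Rightarrow> bool" where
  "Ck_on 0 U f \<longleftrightarrow> continuous_on U f"
| "Ck_on (Suc k) U f \<longleftrightarrow>
     (\<forall>x\<in>U. f differentiable (at x)) \<and>
     (\<forall>v. Ck_on k U (\<lambda>x. frechet_derivative f (at x) v))"

definition smooth_on :: "'a::real_normed_vector set \<Rightarrow> ('a \<Rightarrow> real) \<Rightarrow> bool" where
  "smooth_on U f \<longleftrightarrow> (\<forall>k. Ck_on k U f)"

text \<open>Functions on \<open>U\<close> with compact support in \<open>U\<close> are represented by their extensions by zero to
  the whole space.\<close>

definition C0_infinity :: "'a::real_normed_vector set \<Rightarrow> ('a \<Rightarrow> real) set" where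
  "C0_infinity U = {f. smooth_on U f \<and> compact (closure (support_on UNIV f))
                       \<and> closure (support_on UNIV f) \<subseteq> U}"

definition grad :: "(real ^ 'n \<Rightarrow> real) \<Rightarrow> real ^ 'n::finite \<Rightarrow> real ^ 'n" where
  "grad g x = (\<chi> i. frechet_derivative g (at x) (axis i 1))"

text \<open>Real powers of \<open>[0, \<infinity>]\<close>, meant for exponents \<open>p > 0\<close> only.\<close>

definition ennreal_powr :: "ennreal \<Rightarrow> real \<Rightarrow> ennreal" where
  "ennreal_powr a p = (if a = top then top else ennreal (enn2real a powr p))"

text \<open>Integrals are taken in \<open>[0, \<infinity>]\<close>, so that they may diverge.\<close>

definition weighted_power_integral :: "real \<Rightarrow> real \<Rightarrow> ((real ^ 'n::finite) \<times> real \<Rightarrow> real) \<Rightarrow> ennreal"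
  where
  "weighted_power_integral b q f =
     (\<integral>\<^sup>+ z \<in> half_space. ennreal (snd z powr b * \<bar>f z\<bar> powr q) \<partial>lborel)"

definition weighted_energy :: "real \<Rightarrow> ((real ^ 'n::finite) \<times> real \<Rightarrow> real) \<Rightarrow> ennreal" where
  "weighted_energy a f =
     (\<integral>\<^sup>+ (x', t) \<in> half_space.
        ennreal (t powr a * ((norm (grad (\<lambda>y. f (y, t)) x'))\<^sup>2 + (deriv (\<lambda>s. f (x', s)) t)\<^sup>2))
      \<partial>lborel)"

end

theory Submission
  imports Defs
begin

text \<open>
  Write \<open>N\<close> for the dimension, \<open>t\<close> for the last coordinate and \<open>\<alpha> = (B Q + 2 A) / 2\<close>. The idea is
  to deduce the inequality from two inequalities in \<open>L\<^sup>1\<close> for a power of \<open>f\<close>. For a function \<open>G \<ge> 0\<close>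
  on the half-space let \<open>Y\<close> be the integral of \<open>t\<^sup>\<alpha> \<bar>\<nabla>G\<bar>\<close>. If \<open>\<alpha> \<noteq> 0\<close>, integration by parts on vertical
  lines gives Hardy's inequality \<open>\<bar>\<alpha>\<bar> \<integral> t\<^bsup>\<alpha> - 1\<^esup> G \<le> Y\<close>, and in every case it bounds \<open>t\<^sup>\<alpha> G\<close> at a point by
  the integral of \<open>t\<^sup>\<alpha> \<bar>\<nabla>G\<bar>\<close> over the vertical line through this point. On horizontal lines the
  latter bound is immediate. Gagliardo's product argument (\<open>Gagliardo_prod_le\<close>) turns these bounds along all coordinate lines into
  \<open>\<integral> (t\<^sup>\<alpha> G)\<^bsup>N / (N - 1)\<^esup> \<le> Y\<^bsup>N / (N - 1)\<^esup>\<close>, with no loss at the critical exponent.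

  If \<open>\<alpha> \<ge> 0\<close>, the boundary terms at \<open>t = 0\<close> have the favourable sign, so that \<open>G\<close> may be arbitrary on
  the boundary. If \<open>\<alpha> < 0\<close>, one integrates upwards from \<open>t = 0\<close> instead of downwards from infinity, and
  \<open>G\<close> has to vanish near the boundary. If \<open>\<alpha> = 0\<close>, only the second inequality remains; for \<open>A = B = 0\<close>
  it suffices because \<open>Q\<close> is then the critical exponent.

  Put \<open>s = Q / 2 + 1\<close>, \<open>q = Q / s\<close> and \<open>G = \<bar>f\<bar>\<^sup>s\<close>. Hoelder's inequality between the two bounds
  (\<open>weighted_interpolation\<close>) yields \<open>X \<le> K Y\<^sup>q\<close> for \<open>X = \<integral> t\<^bsup>B Q\<^esup> \<bar>f\<bar>\<^sup>Q\<close>; the hypotheses on \<open>A\<close>, \<open>B\<close>, \<open>Q\<close>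
  say that the exponents match and that \<open>q \<le> N / (N - 1)\<close>. The Cauchy-Schwarz inequality gives
  \<open>Y\<^sup>2 \<le> s\<^sup>2 X E\<close> with the energy \<open>E\<close> on the right-hand side of the claim
  (\<open>power_energy_cauchy_schwarz\<close>). As \<open>Y\<close> is finite, so is \<open>X\<close>, and dividing by \<open>X\<close> leaves
  \<open>X\<^bsup>2 / Q\<^esup> \<le> K\<^bsup>2 / q\<^esup> s\<^sup>2 E\<close>.
\<close>

section \<open>Powers and Hoelder's inequality in the extended nonnegative reals\<close>

lemma ennreal_powr_simps [simp]:
  "ennreal_powr top p = top" "ennreal_powr 0 p = 0"
  by (simp_all add: ennreal_powr_def)

lemma ennreal_powr_ennreal [simp]: "0 \<le> x \<Longrightarrow> ennreal_powr (ennreal x) p = ennreal (x powr p)"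
  by (simp add: ennreal_powr_def)

lemma ennreal_powr_one [simp]: "ennreal_powr a 1 = a"
  by (cases a) auto

lemma measurable_ennreal_powr [measurable]:
  assumes [measurable]: "g \<in> borel_measurable M"
  shows "(\<lambda>x. ennreal_powr (g x) p) \<in> borel_measurable M"
  unfolding ennreal_powr_def by measurable

lemma ennreal_powr_mono:
  assumes "a \<le> b" "0 \<le> p"
  shows "ennreal_powr a p \<le> ennreal_powr b p"
proof (cases b)
  case (real y)
  with assms show ?thesis
    by (cases a) (auto intro!: ennreal_leI powr_mono2 simp: top_unique)
qed simp

lemma ennreal_powr_mult: "ennreal_powr (a * b) p = ennreal_powr a p * ennreal_powr b p"
proof (cases "a = 0 \<or> b = 0")
  case False
  have "ennreal_powr (a * top) p = ennreal_powr a p * top" if "a \<noteq> 0" for a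
    using that by (cases a) (auto simp: ennreal_mult_top)
  with False show ?thesis
    by (cases a; cases b) (auto simp: ennreal_mult_top ennreal_top_mult powr_mult simp flip: ennreal_mult)
qed auto

lemma ennreal_powr_powr: "ennreal_powr (ennreal_powr a p) r = ennreal_powr a (p * r)"
  by (cases a) (auto simp: powr_powr)

lemma ennreal_powr_add:
  "0 < a \<Longrightarrow> ennreal_powr a p * ennreal_powr a r = ennreal_powr a (p + r)"
  by (cases a) (auto simp: powr_add ennreal_top_mult simp flip: ennreal_mult)

lemma ennreal_powr_eq_0_iff [simp]: "ennreal_powr a p = 0 \<longleftrightarrow> a = 0"
  by (cases a) auto

lemma ennreal_powr_eq_top_iff [simp]: "ennreal_powr a p = top \<longleftrightarrow> a = top"
  by (cases a) auto

lemma ennreal_powr_sum: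
  assumes "finite K" "K \<noteq> {}"
  shows "(\<Prod>k\<in>K. ennreal_powr a (p k)) = ennreal_powr a (\<Sum>k\<in>K. p k)"
  using assms
proof (induction rule: finite_ne_induct)
  case (insert k K)
  then show ?case by (cases "a = 0") (auto simp: ennreal_powr_add zero_less_iff_neq_zero)
qed simp

text \<open>For finite positive entries this is Jensen's inequality for \<open>exp\<close> at the logarithms. A zero
  entry annihilates the left-hand side, and an infinite one makes the right-hand side infinite because
  its weight is positive.\<close>

lemma weighted_arith_geo_mean_ennreal:
  assumes K: "finite K" "K \<noteq> {}" and w: "\<And>k. k \<in> K \<Longrightarrow> 0 < w k" "(\<Sum>k\<in>K. w k) = 1"
  shows "(\<Prod>k\<in>K. ennreal_powr (a k) (w k)) \<le> (\<Sum>k\<in>K. ennreal (w k) * a k)"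
proof (cases "\<exists>k\<in>K. a k = top")
  case True
  then obtain k where k: "k \<in> K" "a k = top" by blast
  have "ennreal (w k) * a k = top"
    using w(1)[OF k(1)] k by (simp add: ennreal_mult_top)
  with k K have "(\<Sum>k\<in>K. ennreal (w k) * a k) = top"
    using member_le_sum[of k K "\<lambda>k. ennreal (w k) * a k"] by (auto simp: top_unique)
  then show ?thesis by simp
next
  case False
  define r where "r k = enn2real (a k)" for k
  have a: "a k = ennreal (r k)" "0 \<le> r k" if "k \<in> K" for k
    using False that by (auto simp: r_def less_top)
  have real: "(\<Prod>k\<in>K. r k powr w k) \<le> (\<Sum>k\<in>K. w k * r k)"
  proof (cases "\<exists>k\<in>K. r k = 0")
    case True
    then have "(\<Prod>k\<in>K. r k powr w k) = 0" using K by (auto intro!: prod_zero)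
    then show ?thesis using a w(1) by (auto intro!: sum_nonneg simp: less_imp_le)
  next
    case False
    then have pos: "0 < r k" if "k \<in> K" for k using a(2)[OF that] that by force
    have "(\<Prod>k\<in>K. r k powr w k) = exp (\<Sum>k\<in>K. w k *\<^sub>R ln (r k))"
      using pos[THEN less_imp_neq] K by (simp add: exp_sum powr_def cong: prod.cong)
    also have "\<dots> \<le> (\<Sum>k\<in>K. w k * exp (ln (r k)))"
      by (rule convex_on_sum[OF K exp_convex w(2)]) (auto intro: less_imp_le w(1))
    also have "\<dots> = (\<Sum>k\<in>K. w k * r k)"
      using pos by (intro sum.cong) auto
    finally show ?thesis .
  qed
  have "(\<Prod>k\<in>K. ennreal_powr (a k) (w k)) = ennreal (\<Prod>k\<in>K. r k powr w k)"
    using a by (simp flip: prod_ennreal)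
  also have "\<dots> \<le> ennreal (\<Sum>k\<in>K. w k * r k)" by (rule ennreal_leI[OF real])
  also have "\<dots> = (\<Sum>k\<in>K. ennreal (w k * r k))"
    using a w(1) by (subst sum_ennreal) (auto simp: less_imp_le)
  also have "\<dots> = (\<Sum>k\<in>K. ennreal (w k) * a k)"
    using a w(1) by (intro sum.cong refl) (auto simp: ennreal_mult less_imp_le)
  finally show ?thesis .
qed

text \<open>Hoelder's inequality for finitely many factors with exponents \<open>1 / w k\<close>: normalise every
  factor to have integral 1 and integrate the inequality of the means. The normalisation is
  impossible only if some factor vanishes almost everywhere, or if the right-hand side is infinite.\<close>

lemma Hoelder_prod_nn_integral:
  assumes K: "finite K" "K \<noteq> {}" and w: "\<And>k. k \<in> K \<Longrightarrow> 0 < w k" "(\<Sum>k\<in>K. w k) = 1"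
    and [measurable]: "\<And>k. k \<in> K \<Longrightarrow> g k \<in> borel_measurable M"
  shows "(\<integral>\<^sup>+x. (\<Prod>k\<in>K. ennreal_powr (g k x) (w k)) \<partial>M)
    \<le> (\<Prod>k\<in>K. ennreal_powr (\<integral>\<^sup>+x. g k x \<partial>M) (w k))"
proof -
  define G where "G k = (\<integral>\<^sup>+x. g k x \<partial>M)" for k
  consider k where "k \<in> K" "G k = 0" | k where "\<And>k. k \<in> K \<Longrightarrow> G k \<noteq> 0" "k \<in> K" "G k = top"
    | "\<And>k. k \<in> K \<Longrightarrow> G k \<noteq> 0 \<and> G k \<noteq> top" by blast
  then show ?thesis
  proof cases
    case (1 k)
    then have "AE x in M. g k x = 0" by (simp add: G_def nn_integral_0_iff_AE)
    then have "AE x in M. (\<Prod>k\<in>K. ennreal_powr (g k x) (w k)) = 0"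
      by eventually_elim (use 1 K in auto)
    then have "(\<integral>\<^sup>+x. (\<Prod>k\<in>K. ennreal_powr (g k x) (w k)) \<partial>M) = 0"
      by (subst nn_integral_0_iff_AE) auto
    then show ?thesis by simp
  next
    case (2 k)
    then have "(\<Prod>k\<in>K. ennreal_powr (G k) (w k)) = top"
      using K by (auto simp: ennreal_prod_eq_top)
    then show ?thesis by (simp add: G_def)
  next
    case 3
    have G: "G k * (g k x / G k) = g k x" if "k \<in> K" for k x
      using 3[OF that] by (simp add: ennreal_times_divide ennreal_mult_divide_eq mult.commute[of "G k"])
    have "(\<integral>\<^sup>+x. (\<Prod>k\<in>K. ennreal_powr (g k x) (w k)) \<partial>M)
      = (\<integral>\<^sup>+x. (\<Prod>k\<in>K. ennreal_powr (G k) (w k)) *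
             (\<Prod>k\<in>K. ennreal_powr (g k x / G k) (w k)) \<partial>M)"
      by (intro nn_integral_cong)
         (simp add: prod.distrib[symmetric] ennreal_powr_mult[symmetric] G cong: prod.cong)
    also have "\<dots> \<le> (\<integral>\<^sup>+x. (\<Prod>k\<in>K. ennreal_powr (G k) (w k)) *
             (\<Sum>k\<in>K. ennreal (w k) * (g k x / G k)) \<partial>M)"
      by (intro nn_integral_mono mult_left_mono weighted_arith_geo_mean_ennreal K w) auto
    also have "\<dots> = (\<Prod>k\<in>K. ennreal_powr (G k) (w k)) * (\<Sum>k\<in>K. ennreal (w k) * (G k / G k))"
      by (simp add: nn_integral_cmult nn_integral_sum nn_integral_divide G_def)
    also have "(\<Sum>k\<in>K. ennreal (w k) * (G k / G k)) = (\<Sum>k\<in>K. ennreal (w k))"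
      using 3 by (intro sum.cong) (auto simp: less_top)
    also have "\<dots> = 1" using w by (subst sum_ennreal) (auto simp: less_imp_le)
    finally show ?thesis by (simp add: G_def)
  qed
qed

lemma Hoelder_nn_integral:
  assumes w: "0 < w" "w < 1" and [measurable]: "g \<in> borel_measurable M" "h \<in> borel_measurable M"
  shows "(\<integral>\<^sup>+x. ennreal_powr (g x) (1 - w) * ennreal_powr (h x) w \<partial>M)
    \<le> ennreal_powr (\<integral>\<^sup>+x. g x \<partial>M) (1 - w) * ennreal_powr (\<integral>\<^sup>+x. h x \<partial>M) w"
  using Hoelder_prod_nn_integral[of "UNIV :: bool set" "\<lambda>k. if k then 1 - w else w"
      "\<lambda>k. if k then g else h" M] w
  by (simp add: UNIV_bool mult.commute)

section \<open>The product inequality of Gagliardo\<close>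

text \<open>The coordinates in \<open>J\<close> are integrated out, but the result stays a function on the whole
  space, constant in these coordinates: marginals with respect to different sets \<open>J\<close> can then be
  multiplied pointwise.\<close>

definition marginal :: "'a set \<Rightarrow> ('a::euclidean_space \<Rightarrow> ennreal) \<Rightarrow> 'a \<Rightarrow> ennreal" where
  "marginal J h x = (\<integral>\<^sup>+y. h (x + (\<Sum>b\<in>J. y b *\<^sub>R b)) \<partial>PiM J (\<lambda>_. lborel))"

definition line_integral :: "'a \<Rightarrow> ('a::euclidean_space \<Rightarrow> ennreal) \<Rightarrow> 'a \<Rightarrow> ennreal" where
  "line_integral b h x = (\<integral>\<^sup>+s. h (x + s *\<^sub>R b) \<partial>lborel)"

lemma product_sigma_finite_lborel: "product_sigma_finite (\<lambda>_. lborel :: real measure)"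
  by standard

lemma measurable_marginal [measurable]:
  assumes J: "finite J" and [measurable]: "h \<in> borel_measurable borel"
  shows "marginal J h \<in> borel_measurable borel"
proof -
  interpret product_sigma_finite "\<lambda>_. lborel :: real measure" by (rule product_sigma_finite_lborel)
  interpret sigma_finite_measure "PiM J (\<lambda>_. lborel :: real measure)"
    by (rule sigma_finite[OF J])
  show ?thesis unfolding marginal_def[abs_def] by measurable
qed

lemma measurable_line_integral [measurable]:
  assumes [measurable]: "h \<in> borel_measurable borel"
  shows "line_integral b h \<in> borel_measurable borel"
  unfolding line_integral_def[abs_def] by measurable

lemma marginal_empty [simp]: "marginal {} h = h"
proof -
  interpret product_sigma_finite "\<lambda>_. lborel :: real measure" by (rule product_sigma_finite_lborel)
  show ?thesis by (simp add: marginal_def fun_eq_iff PiM_empty nn_integral_count_space_finite)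
qed

lemma marginal_insert:
  assumes J: "finite J" "j \<notin> J" and [measurable]: "h \<in> borel_measurable borel"
  shows "marginal (insert j J) h = line_integral j (marginal J h)"
proof
  fix x
  interpret product_sigma_finite "\<lambda>_. lborel :: real measure" by (rule product_sigma_finite_lborel)
  have "(\<Sum>b\<in>J. (y(j := s)) b *\<^sub>R b) = (\<Sum>b\<in>J. y b *\<^sub>R b)" for y :: "'a \<Rightarrow> real" and s
    using J by (intro sum.cong) auto
  then show "marginal (insert j J) h x = line_integral j (marginal J h) x"
    unfolding marginal_def line_integral_def using J
    by (subst product_nn_integral_insert_rev) (simp_all add: add.assoc)
qed

lemma marginal_singleton: "h \<in> borel_measurable borel \<Longrightarrow> marginal {j} h = line_integral j h"
  using marginal_insert[of "{}" j h] by simp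

lemma marginal_Basis:
  assumes [measurable]: "h \<in> borel_measurable borel"
  shows "marginal Basis h x = (\<integral>\<^sup>+y. h y \<partial>lborel)"
proof -
  have "(\<integral>\<^sup>+y. h y \<partial>lborel) = (\<integral>\<^sup>+y. h (x + y) \<partial>lborel)"
    by (subst lborel_distr_plus[symmetric, of x]) (simp add: nn_integral_distr)
  also have "\<dots> = marginal Basis h x"
    unfolding marginal_def by (subst lborel_eq) (simp add: nn_integral_distr)
  finally show ?thesis by simp
qed

lemma line_integral_shift:
  assumes [measurable]: "h \<in> borel_measurable borel"
  shows "line_integral b h (x + s *\<^sub>R b) = line_integral b h x"
  unfolding line_integral_def
  by (subst (2) nn_integral_real_affine[where c = 1 and t = s])
     (simp_all add: algebra_simps)

lemma line_integral_mono: "(\<And>y. h y \<le> k y) \<Longrightarrow> line_integral b h x \<le> line_integral b k x"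
  unfolding line_integral_def by (intro nn_integral_mono) auto

text \<open>Gagliardo's argument, as an induction over the coordinates integrated so far. When the
  coordinate \<open>j\<close> is integrated next, the factor with index \<open>j\<close> is already constant in it and comes
  out of the integral; the \<open>DIM('a) - 1\<close> remaining factors are handled by Hoelder's inequality with
  equal weights \<open>p\<close>. Keeping marginals of all factors in the statement makes this step uniform.\<close>

lemma marginal_prod_le:
  fixes h :: "'a \<Rightarrow> 'a::euclidean_space \<Rightarrow> ennreal"
  assumes dim: "DIM('a) \<ge> 2" and [measurable]: "\<And>b. b \<in> Basis \<Longrightarrow> h b \<in> borel_measurable borel"
    and p: "p = 1 / (real DIM('a) - 1)"
    and "finite J" "J \<subseteq> Basis"
  shows "marginal J (\<lambda>x. \<Prod>b\<in>Basis. ennreal_powr (line_integral b (h b) x) p) x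
    \<le> (\<Prod>b\<in>Basis. ennreal_powr (marginal (insert b J) (h b) x) p)"
  using \<open>finite J\<close> \<open>J \<subseteq> Basis\<close>
proof (induction arbitrary: x rule: finite_induct)
  case empty
  show ?case by (simp add: marginal_singleton cong: prod.cong)
next
  case (insert j J)
  let ?B = "Basis - {j}"
  define H where "H b = marginal (insert b J) (h b)" for b
  have j: "j \<in> Basis" and [simp]: "finite J" using insert by auto
  have H [measurable]: "H b \<in> borel_measurable borel" if "b \<in> Basis" for b
    unfolding H_def using that by measurable
  have card: "real (card ?B) = real DIM('a) - 1" and B: "finite ?B" "?B \<noteq> {}"
    using dim j by (auto simp: card_Diff_singleton dest: card_mono[rotated])
  have Hj: "H j (x + s *\<^sub>R j) = H j x" for s
    using j insert by (simp add: H_def marginal_insert line_integral_shift)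
  have int: "line_integral j (H b) = marginal (insert b (insert j J)) (h b)" if "b \<in> ?B" for b
  proof (cases "b \<in> J")
    case True
    then show ?thesis using that insert by (simp add: H_def insert_absorb marginal_insert)
  next
    case False
    then show ?thesis
      using that insert marginal_insert[of "insert b J" j "h b"]
      by (auto simp: H_def insert_commute)
  qed
  have "marginal (insert j J) (\<lambda>x. \<Prod>b\<in>Basis. ennreal_powr (line_integral b (h b) x) p) x
    = line_integral j (marginal J (\<lambda>x. \<Prod>b\<in>Basis. ennreal_powr (line_integral b (h b) x) p)) x"
    using insert by (subst marginal_insert) simp_all
  also have "\<dots> \<le> line_integral j (\<lambda>x. \<Prod>b\<in>Basis. ennreal_powr (H b x) p) x"
    unfolding H_def using insert by (intro line_integral_mono) simp
  also have "\<dots> = (\<integral>\<^sup>+s. ennreal_powr (H j x) p *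
      (\<Prod>b\<in>?B. ennreal_powr (H b (x + s *\<^sub>R j)) p) \<partial>lborel)"
    unfolding line_integral_def using j by (simp add: prod.remove Hj)
  also have "\<dots> = ennreal_powr (H j x) p *
      (\<integral>\<^sup>+s. (\<Prod>b\<in>?B. ennreal_powr (H b (x + s *\<^sub>R j)) p) \<partial>lborel)"
    by (rule nn_integral_cmult) measurable
  also have "\<dots> \<le> ennreal_powr (H j x) p *
      (\<Prod>b\<in>?B. ennreal_powr (\<integral>\<^sup>+s. H b (x + s *\<^sub>R j) \<partial>lborel) p)"
    using dim card B by (intro mult_left_mono Hoelder_prod_nn_integral) (auto simp: p)
  also have "\<dots> = ennreal_powr (H j x) p *
      (\<Prod>b\<in>?B. ennreal_powr (marginal (insert b (insert j J)) (h b) x) p)"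
    by (intro arg_cong2[where f = "(*)"] prod.cong refl)
       (simp only: int[symmetric] line_integral_def)
  also have "\<dots> = (\<Prod>b\<in>Basis. ennreal_powr (marginal (insert b (insert j J)) (h b) x) p)"
    using j by (simp add: prod.remove H_def)
  finally show ?case .
qed

lemma Gagliardo_prod_le:
  fixes h :: "'a \<Rightarrow> 'a::euclidean_space \<Rightarrow> ennreal"
  assumes "DIM('a) \<ge> 2" and [measurable]: "\<And>b. b \<in> Basis \<Longrightarrow> h b \<in> borel_measurable borel"
    and p: "p = 1 / (real DIM('a) - 1)"
  shows "(\<integral>\<^sup>+x. (\<Prod>b\<in>Basis. ennreal_powr (line_integral b (h b) x) p) \<partial>lborel)
    \<le> (\<Prod>b\<in>Basis. ennreal_powr (\<integral>\<^sup>+x. h b x \<partial>lborel) p)"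
  using marginal_prod_le[OF assms, where J = Basis and x = 0]
  by (simp add: marginal_Basis insert_absorb cong: prod.cong)

text \<open>The endpoint Sobolev inequality without derivatives: a function that is dominated, along
  every coordinate direction, by the line integral of \<open>h\<close> has its critical power controlled by the
  integral of \<open>h\<close>. For \<open>h\<close> the length of the gradient of \<open>u\<close> this is the Gagliardo-Nirenberg
  inequality; only one-sided integration from infinity is needed to apply it, so \<open>u\<close> may jump to 0
  across the boundary of a half-space.\<close>

lemma Gagliardo_Nirenberg:
  fixes u h :: "'a::euclidean_space \<Rightarrow> ennreal"
  assumes dim: "DIM('a) \<ge> 2" and [measurable]: "h \<in> borel_measurable borel"
    and le: "\<And>b x. b \<in> Basis \<Longrightarrow> u x \<le> line_integral b h x"
    and r: "r = real DIM('a) / (real DIM('a) - 1)"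
  shows "(\<integral>\<^sup>+x. ennreal_powr (u x) r \<partial>lborel) \<le> ennreal_powr (\<integral>\<^sup>+x. h x \<partial>lborel) r"
proof -
  define p where "p = 1 / (real DIM('a) - 1)"
  have prod: "(\<Prod>b\<in>(Basis :: 'a set). ennreal_powr a p) = ennreal_powr a r" for a
    by (subst ennreal_powr_sum) (simp_all add: r p_def)
  have "(\<integral>\<^sup>+x. ennreal_powr (u x) r \<partial>lborel)
    \<le> (\<integral>\<^sup>+x. (\<Prod>b\<in>Basis. ennreal_powr (line_integral b h x) p) \<partial>lborel)"
    unfolding prod[symmetric] using dim
    by (intro nn_integral_mono prod_mono_ennreal ennreal_powr_mono le) (auto simp: p_def)
  also have "\<dots> \<le> (\<Prod>b\<in>(Basis :: 'a set). ennreal_powr (\<integral>\<^sup>+x. h x \<partial>lborel) p)"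
    by (rule Gagliardo_prod_le[OF dim _ p_def]) measurable
  finally show ?thesis by (simp only: prod)
qed

section \<open>Weighted inequalities on the half-line\<close>

lemma FTC_real_derivative:
  fixes g g' :: "real \<Rightarrow> real"
  assumes "a \<le> b" and "\<And>t. t \<in> {a..b} \<Longrightarrow> (g has_real_derivative g' t) (at t)"
  shows "(g' has_integral (g b - g a)) {a..b}"
  by (rule fundamental_theorem_of_calculus[OF assms(1)])
     (rule has_vector_derivative_at_within[OF
        assms(2)[unfolded has_real_derivative_iff_has_vector_derivative]])

lemma abs_derivative_nn_integral_ge:
  fixes g g' :: "real \<Rightarrow> real"
  assumes "a \<le> b" and deriv: "\<And>t. t \<in> {a..b} \<Longrightarrow> (g has_real_derivative g' t) (at t)"
    and cont: "continuous_on {a..b} g'"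
  shows "ennreal \<bar>g b - g a\<bar> \<le> (\<integral>\<^sup>+t\<in>{a..b}. ennreal \<bar>g' t\<bar> \<partial>lborel)"
proof -
  have I: "(g' has_integral (g b - g a)) {a..b}"
    using \<open>a \<le> b\<close> by (rule FTC_real_derivative) (rule deriv)
  have J: "((\<lambda>t. \<bar>g' t\<bar>) has_integral integral {a..b} (\<lambda>t. \<bar>g' t\<bar>)) {a..b}"
    using cont by (intro integrable_integral integrable_continuous_real continuous_intros)
  have "\<bar>g b - g a\<bar> \<le> integral {a..b} (\<lambda>t. \<bar>g' t\<bar>)"
    using integral_norm_bound_integral[OF has_integral_integrable[OF I] has_integral_integrable[OF J]]
    by (simp add: integral_unique[OF I])
  then show ?thesis
    using nn_integral_has_integral_lebesgue'[OF _ J] by (simp add: ennreal_leI)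
qed

text \<open>Both one-dimensional estimates come from the single identity
  \<open>b powr \<alpha> * g b - a powr \<alpha> * g a = \<integral> \<alpha> * t powr (\<alpha> - 1) * g t + t powr \<alpha> * g' t\<close> on \<open>[a, b]\<close>. If \<open>g\<close> vanishes
  at the right endpoint for \<open>\<alpha> \<ge> 0\<close>, or at the left one for \<open>\<alpha> \<le> 0\<close>, then the boundary term and the
  term with \<open>\<alpha>\<close> have the same sign, and the derivative term controls their sum.\<close>

lemma weighted_hardy_interval:
  fixes g g' :: "real \<Rightarrow> real"
  assumes ab: "0 < a" "a \<le> b"
    and deriv: "\<And>t. t \<in> {a..b} \<Longrightarrow> (g has_real_derivative g' t) (at t)"
    and cont: "continuous_on {a..b} g'" and nonneg: "\<And>t. 0 \<le> g t"
    and sign: "0 \<le> \<alpha> \<and> g b = 0 \<or> \<alpha> \<le> 0 \<and> g a = 0"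
  shows "ennreal (a powr \<alpha> * g a + b powr \<alpha> * g b)
      + ennreal \<bar>\<alpha>\<bar> * (\<integral>\<^sup>+t\<in>{a..b}. ennreal (t powr (\<alpha> - 1) * g t) \<partial>lborel)
    \<le> (\<integral>\<^sup>+t\<in>{a..b}. ennreal (t powr \<alpha> * \<bar>g' t\<bar>) \<partial>lborel)"
proof -
  define F where "F t = t powr \<alpha> * g t" for t
  define K where "K = integral {a..b} (\<lambda>t. t powr (\<alpha> - 1) * g t)"
  define L where "L = integral {a..b} (\<lambda>t. t powr \<alpha> * \<bar>g' t\<bar>)"
  have cont_g: "continuous_on {a..b} g"
    using deriv by (meson DERIV_isCont continuous_at_imp_continuous_on)
  have K: "((\<lambda>t. t powr (\<alpha> - 1) * g t) has_integral K) {a..b}"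
    unfolding K_def using ab cont_g
    by (intro integrable_integral integrable_continuous_real continuous_intros) auto
  have L: "((\<lambda>t. t powr \<alpha> * \<bar>g' t\<bar>) has_integral L) {a..b}"
    unfolding L_def using ab cont
    by (intro integrable_integral integrable_continuous_real continuous_intros) auto
  have "(F has_real_derivative (\<alpha> * (t powr (\<alpha> - 1) * g t) + t powr \<alpha> * g' t)) (at t)"
    if "t \<in> {a..b}" for t
    unfolding F_def[abs_def] using that ab
    by (intro DERIV_cong[OF DERIV_mult[OF has_real_derivative_powr deriv]])
       (auto simp: algebra_simps)
  from FTC_real_derivative[OF ab(2) this]
  have "((\<lambda>t. \<alpha> * (t powr (\<alpha> - 1) * g t) + t powr \<alpha> * g' t) has_integral (F b - F a)) {a..b}"
    .
  from has_integral_diff[OF this has_integral_mult_right[OF K, of \<alpha>]]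
  have "((\<lambda>t. t powr \<alpha> * g' t) has_integral (F b - F a - \<alpha> * K)) {a..b}" by simp
  note I = this
  have "\<bar>F b - F a - \<alpha> * K\<bar> \<le> L"
    using integral_norm_bound_integral[OF has_integral_integrable[OF I] has_integral_integrable[OF L]]
    by (simp add: integral_unique[OF I] integral_unique[OF L] abs_mult)
  moreover have "0 \<le> F t" for t using nonneg by (simp add: F_def)
  moreover have K0: "0 \<le> K"
    using K by (rule has_integral_nonneg) (simp add: nonneg)
  ultimately have le: "F a + F b + \<bar>\<alpha>\<bar> * K \<le> L"
    using sign by (auto simp: F_def)
  have "ennreal (F a + F b + \<bar>\<alpha>\<bar> * K) = ennreal (F a + F b) + ennreal \<bar>\<alpha>\<bar> * ennreal K"
    using K0 nonneg by (simp add: F_def ennreal_mult)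
  with ennreal_leI[OF le] show ?thesis
    using nn_integral_has_integral_lebesgue'[OF _ K] nn_integral_has_integral_lebesgue'[OF _ L] nonneg
    by (simp add: F_def)
qed

text \<open>For \<open>\<alpha> \<ge> 0\<close> nothing is assumed about \<open>g\<close> near 0: this is why functions need not vanish on the
  boundary of the half-space in that case. The first estimate follows by choosing the interval to begin
  or to end at \<open>t\<close>, the second one by exhausting the half-line.\<close>

lemma weighted_hardy_halfline:
  fixes g g' :: "real \<Rightarrow> real"
  assumes deriv: "\<And>t. 0 < t \<Longrightarrow> (g has_real_derivative g' t) (at t)"
    and cont: "continuous_on {0<..} g'" and nonneg: "\<And>t. 0 \<le> g t"
    and supp: "\<And>t. R \<le> t \<Longrightarrow> g t = 0"
    and sign: "0 \<le> \<alpha> \<or> 0 < \<epsilon> \<and> (\<forall>t<\<epsilon>. g t = 0)"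
  shows "\<And>t. 0 < t \<Longrightarrow> ennreal (t powr \<alpha> * g t)
      \<le> (\<integral>\<^sup>+s\<in>{0<..}. ennreal (s powr \<alpha> * \<bar>g' s\<bar>) \<partial>lborel)"
    and "ennreal \<bar>\<alpha>\<bar> * (\<integral>\<^sup>+t\<in>{0<..}. ennreal (t powr (\<alpha> - 1) * g t) \<partial>lborel)
      \<le> (\<integral>\<^sup>+s\<in>{0<..}. ennreal (s powr \<alpha> * \<bar>g' s\<bar>) \<partial>lborel)"
proof -
  let ?R = "\<integral>\<^sup>+s\<in>{0<..}. ennreal (s powr \<alpha> * \<bar>g' s\<bar>) \<partial>lborel"
  let ?I = "\<lambda>a b. \<integral>\<^sup>+t\<in>{a..b}. ennreal (t powr (\<alpha> - 1) * g t) \<partial>lborel"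
  have *: "ennreal (a powr \<alpha> * g a + b powr \<alpha> * g b) + ennreal \<bar>\<alpha>\<bar> * ?I a b \<le> ?R"
    if "0 < a" "a \<le> b" "0 \<le> \<alpha> \<and> g b = 0 \<or> \<alpha> \<le> 0 \<and> g a = 0" for a b
  proof -
    have "ennreal (a powr \<alpha> * g a + b powr \<alpha> * g b) + ennreal \<bar>\<alpha>\<bar> * ?I a b
      \<le> (\<integral>\<^sup>+t\<in>{a..b}. ennreal (t powr \<alpha> * \<bar>g' t\<bar>) \<partial>lborel)"
      using that by (intro weighted_hardy_interval deriv nonneg continuous_on_subset[OF cont]) auto
    also have "\<dots> \<le> ?R"
      using that by (intro nn_integral_mono) (auto simp: indicator_def)
    finally show ?thesis .
  qed
  show "ennreal (t powr \<alpha> * g t) \<le> ?R" if "0 < t" for t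
  proof (cases "0 \<le> \<alpha>")
    case True
    then have "ennreal (t powr \<alpha> * g t) + ennreal \<bar>\<alpha>\<bar> * ?I t (max t R) \<le> ?R"
      using *[of t "max t R"] supp[of "max t R"] that by (simp split: if_splits)
    then show ?thesis by (rule order_trans[rotated]) simp
  next
    case False
    let ?a = "min t (\<epsilon> / 2)"
    have "?a < \<epsilon>" "0 < ?a" using sign False that by auto
    then have "ennreal (t powr \<alpha> * g t) + ennreal \<bar>\<alpha>\<bar> * ?I ?a t \<le> ?R"
      using *[of ?a t] sign False by auto
    then show ?thesis by (rule order_trans[rotated]) simp
  qed
  have I: "ennreal \<bar>\<alpha>\<bar> * ?I a b \<le> ?R" if "0 < a" "a \<le> b" for a b
  proof -
    \<comment> \<open>For negative \<open>\<alpha>\<close> the interval is enlarged until its left end lies where \<open>g\<close> vanishes, so that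
      the estimate on intervals applies.\<close>
    define a' where "a' = (if 0 \<le> \<alpha> then a else min a (\<epsilon> / 2))"
    have a': "0 < a'" "a' \<le> a" "0 \<le> \<alpha> \<or> g a' = 0" using that sign by (auto simp: a'_def min_def)
    have "ennreal \<bar>\<alpha>\<bar> * ?I a b \<le> ennreal \<bar>\<alpha>\<bar> * ?I a' (max b R)"
      using a' by (intro mult_left_mono nn_integral_mono) (auto simp: indicator_def)
    also have "\<dots> \<le> ennreal (a' powr \<alpha> * g a' + max b R powr \<alpha> * g (max b R)) + \<dots>" by simp
    also have "\<dots> \<le> ?R" using a' that supp by (intro *) auto
    finally show ?thesis .
  qed
  have g: "continuous_on {0<..} g"
    using deriv by (meson DERIV_isCont continuous_at_imp_continuous_on greaterThan_iff)
  define k where "k t = ennreal (t powr (\<alpha> - 1) * g t) * indicator {0<..} t" for t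
  have "(\<lambda>t. indicator {0<..} t *\<^sub>R g t) \<in> borel_measurable borel"
    using g by (intro borel_measurable_continuous_on_indicator) auto
  then have "(\<lambda>t. ennreal (t powr (\<alpha> - 1) * (indicator {0<..} t *\<^sub>R g t))) \<in> borel_measurable borel"
    by measurable
  also have "(\<lambda>t. ennreal (t powr (\<alpha> - 1) * (indicator {0<..} t *\<^sub>R g t))) = k"
    by (auto simp: k_def fun_eq_iff indicator_def)
  finally have [measurable]: "k \<in> borel_measurable borel" .
  let ?J = "\<lambda>n. {1 / real (Suc n)..real (Suc n)}"
  have inc: "incseq ?J"
  proof (rule incseq_SucI)
    fix n
    have "1 / real (Suc (Suc n)) \<le> 1 / real (Suc n)" by (rule frac_le) auto
    then show "?J n \<subseteq> ?J (Suc n)" by (intro atLeastatMost_subset_iff[THEN iffD2]) simp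
  qed
  have J0: "?J n \<subseteq> {0<..}" for n
  proof
    fix t assume t: "t \<in> ?J n"
    have "0 < 1 / real (Suc n)" by simp
    also have "\<dots> \<le> t" using t by simp
    finally show "t \<in> {0<..}" by simp
  qed
  have "(\<Union>n. ?J n) = {0::real<..}"
  proof
    show "(\<Union>n. ?J n) \<subseteq> {0<..}" using J0 by blast
    show "{0<..} \<subseteq> (\<Union>n. ?J n)"
    proof
      fix t :: real assume t: "t \<in> {0<..}"
      obtain n where n: "max (1 / t) t \<le> real n" using real_arch_simple by blast
      then have "1 / t \<le> real (Suc n)" "t \<le> real (Suc n)" by auto
      with t have "t \<in> ?J n" by (simp add: field_simps)
      then show "t \<in> (\<Union>n. ?J n)" by blast
    qed
  qed
  then have "(\<integral>\<^sup>+t. k t \<partial>lborel) = (\<integral>\<^sup>+t. k t * indicator (\<Union>n. ?J n) t \<partial>lborel)"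
    by (intro nn_integral_cong) (simp add: k_def indicator_def)
  also have "\<dots> = emeasure (density lborel k) (\<Union>n. ?J n)"
    by (simp add: emeasure_density)
  also have "\<dots> = (SUP n. emeasure (density lborel k) (?J n))"
    using inc by (intro SUP_emeasure_incseq[symmetric]) auto
  also have "\<dots> = (SUP n. \<integral>\<^sup>+t. k t * indicator (?J n) t \<partial>lborel)"
    by (simp add: emeasure_density)
  also have "ennreal \<bar>\<alpha>\<bar> * \<dots> = (SUP n. ennreal \<bar>\<alpha>\<bar> * (\<integral>\<^sup>+t. k t * indicator (?J n) t \<partial>lborel))"
    by (simp add: SUP_mult_left_ennreal)
  also have "\<dots> \<le> ?R"
  proof (rule SUP_least)
    fix n
    have "(\<integral>\<^sup>+t. k t * indicator (?J n) t \<partial>lborel) = ?I (1 / real (Suc n)) (real (Suc n))"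
      by (intro nn_integral_cong) (auto simp: k_def indicator_def simp del: atLeastAtMost_iff of_nat_Suc dest: subsetD[OF J0])
    then show "ennreal \<bar>\<alpha>\<bar> * (\<integral>\<^sup>+t. k t * indicator (?J n) t \<partial>lborel) \<le> ?R"
      using I[of "1 / real (Suc n)" "real (Suc n)"] by (simp add: field_simps)
  qed
  finally show "ennreal \<bar>\<alpha>\<bar> * (\<integral>\<^sup>+t\<in>{0<..}. ennreal (t powr (\<alpha> - 1) * g t) \<partial>lborel) \<le> ?R"
    by (simp add: k_def)
qed

section \<open>Absolute powers\<close>

lemma continuous_on_abs_powr_sgn:
  assumes "0 < p"
  shows "continuous_on UNIV (\<lambda>y::real. \<bar>y\<bar> powr p * sgn y)"
proof -
  have "continuous_on ({0..} \<union> {..0}) (\<lambda>y::real. if 0 \<le> y then y powr p else - ((- y) powr p))"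
    using assms by (intro continuous_on_cases continuous_on_powr' continuous_on_minus
        continuous_on_const continuous_on_id) auto
  moreover have "{0..} \<union> {..0} = (UNIV :: real set)" by auto
  moreover have "(\<lambda>y::real. if 0 \<le> y then y powr p else - ((- y) powr p)) = (\<lambda>y. \<bar>y\<bar> powr p * sgn y)"
    using assms by (auto simp: fun_eq_iff sgn_if)
  ultimately show ?thesis by (simp only:)
qed

lemma DERIV_abs_powr:
  assumes "1 < s"
  shows "((\<lambda>y::real. \<bar>y\<bar> powr s) has_real_derivative s * (\<bar>y\<bar> powr (s - 1) * sgn y)) (at y)"
proof -
  consider "0 < y" | "y < 0" | "y = 0" by linarith
  then show ?thesis
  proof cases
    case 1
    have "((\<lambda>y. y powr s) has_real_derivative s * (\<bar>y\<bar> powr (s - 1) * sgn y)) (at y)"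
      using 1 by (intro DERIV_cong[OF has_real_derivative_powr]) auto
    moreover have "eventually (\<lambda>x. x \<in> {0<..}) (nhds y)"
      using 1 by (intro eventually_nhds_in_open) auto
    ultimately show ?thesis
      by (subst DERIV_cong_ev[OF refl _ refl, where g = "\<lambda>y. y powr s"]) (auto elim!: eventually_mono)
  next
    case 2
    have "((\<lambda>y. (- y) powr s) has_real_derivative s * (\<bar>y\<bar> powr (s - 1) * sgn y)) (at y)"
      using 2 by (intro DERIV_cong[OF DERIV_chain2[OF has_real_derivative_powr DERIV_minus[OF DERIV_ident]]]) auto
    moreover have "eventually (\<lambda>x. x \<in> {..<0}) (nhds y)"
      using 2 by (intro eventually_nhds_in_open) auto
    ultimately show ?thesis
      by (subst DERIV_cong_ev[OF refl _ refl, where g = "\<lambda>y. (- y) powr s"]) (auto elim!: eventually_mono)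
  next
    case 3
    have "isCont (\<lambda>y::real. \<bar>y\<bar> powr (s - 1) * sgn y) 0"
      using continuous_on_abs_powr_sgn[of "s - 1"] assms by (simp add: continuous_on_eq_continuous_at)
    then have "((\<lambda>y::real. \<bar>y\<bar> powr (s - 1) * sgn y) \<longlongrightarrow> 0) (at 0)"
      by (simp add: isCont_def)
    moreover have "eventually (\<lambda>h::real. \<bar>h\<bar> powr (s - 1) * sgn h = \<bar>h\<bar> powr s / h) (at 0)"
      by (auto simp: eventually_at_filter powr_diff sgn_if field_simps)
    ultimately have "((\<lambda>h::real. \<bar>h\<bar> powr s / h) \<longlongrightarrow> 0) (at 0)"
      by (rule Lim_transform_eventually)
    then show ?thesis using 3 by (simp add: DERIV_def)
  qed
qed

section \<open>The Hardy and Gagliardo-Nirenberg inequalities on the half-space\<close>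

lemma open_half_space: "open (half_space :: ('a::topological_space \<times> real) set)"
proof -
  have "half_space = (snd -` {0<..} :: ('a \<times> real) set)" by (auto simp: half_space_def)
  moreover have "open (snd -` {0<..} :: ('a \<times> real) set)"
    by (intro open_vimage open_greaterThan continuous_on_snd continuous_on_id)
  ultimately show ?thesis by simp
qed

lemma half_space_iff [simp]: "z \<in> half_space \<longleftrightarrow> 0 < snd z"
  by (auto simp: half_space_def)

lemma nn_integral_lborel_pair:
  assumes [measurable]: "F \<in> borel_measurable borel"
  shows "(\<integral>\<^sup>+z. F z \<partial>(lborel :: ('a::euclidean_space \<times> 'b::euclidean_space) measure))
    = (\<integral>\<^sup>+x. \<integral>\<^sup>+t. F (x, t) \<partial>lborel \<partial>lborel)"
  by (subst lborel_prod[symmetric], subst lborel.nn_integral_fst[symmetric])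
     (simp_all add: lborel_prod)

text \<open>The last assumption unites the two parts of the theorem: integration by parts in the vertical
  direction with the weight \<open>t powr \<alpha>\<close> has harmless boundary terms either because \<open>\<alpha> \<ge> 0\<close> or because
  \<open>f\<close> vanishes near the boundary.\<close>

locale half_space_function =
  fixes f :: "'a::euclidean_space \<times> real \<Rightarrow> real" and f' :: "'a \<times> real \<Rightarrow> 'a \<times> real \<Rightarrow> real"
    and \<alpha> R \<epsilon> :: real
  assumes deriv: "z \<in> half_space \<Longrightarrow> (f has_derivative f' z) (at z)"
    and cont: "b \<in> Basis \<Longrightarrow> continuous_on half_space (\<lambda>z. f' z b)"
    and supp: "R < norm z \<Longrightarrow> f z = 0"
    and sign: "0 \<le> \<alpha> \<or> 0 < \<epsilon> \<and> (\<forall>z. snd z < \<epsilon> \<longrightarrow> f z = 0)"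
begin

definition grad_norm :: "'a \<times> real \<Rightarrow> real" where
  "grad_norm z = sqrt (\<Sum>b\<in>Basis. (f' z b)\<^sup>2)"

text \<open>The weight \<open>t powr \<alpha>\<close> times the length of the gradient of \<open>\<bar>f\<bar> powr s\<close>, cut off to the
  half-space.\<close>

definition power_energy :: "real \<Rightarrow> 'a \<times> real \<Rightarrow> ennreal" where
  "power_energy s z = ennreal (s * (snd z powr \<alpha> * (\<bar>f z\<bar> powr (s - 1) * grad_norm z)))
     * indicator half_space z"

lemma grad_norm_nonneg [simp]: "0 \<le> grad_norm z"
  by (simp add: grad_norm_def sum_nonneg)

lemma abs_partial_le_grad_norm: "b \<in> Basis \<Longrightarrow> \<bar>f' z b\<bar> \<le> grad_norm z"
  unfolding grad_norm_def
  by (rule real_le_rsqrt) (auto intro!: member_le_sum[where f = "\<lambda>b. (f' z b)\<^sup>2"])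

lemma continuous_on_f: "continuous_on half_space f"
  using deriv has_derivative_continuous by (blast intro: continuous_at_imp_continuous_on)

lemma continuous_on_grad_norm: "continuous_on half_space grad_norm"
  unfolding grad_norm_def[abs_def] by (intro continuous_intros cont)

lemma measurable_half_space:
  assumes "continuous_on half_space F"
  shows "(\<lambda>z. ennreal (F z) * indicator (half_space :: ('a \<times> real) set) z) \<in> borel_measurable borel"
proof -
  have "(\<lambda>z. indicator half_space z *\<^sub>R F z) \<in> borel_measurable borel"
    using assms by (intro borel_measurable_continuous_on_indicator borel_open open_half_space)
  then have "(\<lambda>z. ennreal (indicator half_space z *\<^sub>R F z)) \<in> borel_measurable borel"
    by measurable
  also have "(\<lambda>z. ennreal (indicator half_space z *\<^sub>R F z))
      = (\<lambda>z. ennreal (F z) * indicator half_space z)"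
    by (auto simp: indicator_def fun_eq_iff)
  finally show ?thesis .
qed

lemma measurable_power_energy:
  assumes "1 < s"
  shows "power_energy s \<in> borel_measurable borel"
  unfolding power_energy_def[abs_def] using assms
  by (intro measurable_half_space continuous_on_mult continuous_on_powr' continuous_on_rabs
      continuous_on_const continuous_on_snd continuous_on_id continuous_on_f continuous_on_grad_norm)
     auto

lemma measurable_weighted_power:
  assumes "0 < s"
  shows "(\<lambda>z. ennreal (snd z powr p * \<bar>f z\<bar> powr s) * indicator half_space z) \<in> borel_measurable borel"
  using assms by (intro measurable_half_space continuous_on_mult continuous_on_powr'
      continuous_on_rabs continuous_on_const continuous_on_snd continuous_on_id continuous_on_f) auto

lemma power_deriv_line:
  assumes "1 < s" "z + r *\<^sub>R b \<in> half_space"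
  shows "((\<lambda>r. \<bar>f (z + r *\<^sub>R b)\<bar> powr s) has_real_derivative
      s * (\<bar>f (z + r *\<^sub>R b)\<bar> powr (s - 1) * sgn (f (z + r *\<^sub>R b))) * f' (z + r *\<^sub>R b) b) (at r)"
proof (rule DERIV_chain2[OF DERIV_abs_powr[OF assms(1)]])
  have "((\<lambda>r. z + r *\<^sub>R b) has_derivative (\<lambda>h. h *\<^sub>R b)) (at r)"
    by (auto intro!: derivative_eq_intros)
  from has_derivative_compose[OF this deriv[OF assms(2)]]
  have "((\<lambda>r. f (z + r *\<^sub>R b)) has_derivative (\<lambda>h. f' (z + r *\<^sub>R b) (h *\<^sub>R b))) (at r)" .
  moreover have "(\<lambda>h. f' (z + r *\<^sub>R b) (h *\<^sub>R b)) = (*) (f' (z + r *\<^sub>R b) b)"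
    using linear_scale[OF has_derivative_linear[OF deriv[OF assms(2)]]]
    by (simp add: fun_eq_iff mult.commute)
  ultimately show "((\<lambda>r. f (z + r *\<^sub>R b)) has_real_derivative f' (z + r *\<^sub>R b) b) (at r)"
    by (simp only: has_field_derivative_def)
qed

lemma continuous_on_power_deriv_line:
  assumes "1 < s" "b \<in> Basis" "\<And>r. r \<in> S \<Longrightarrow> z + r *\<^sub>R b \<in> half_space"
  shows "continuous_on S (\<lambda>r. s * (\<bar>f (z + r *\<^sub>R b)\<bar> powr (s - 1) * sgn (f (z + r *\<^sub>R b)))
      * f' (z + r *\<^sub>R b) b)"
proof -
  have line: "continuous_on S (\<lambda>r. z + r *\<^sub>R b)" by (intro continuous_intros)
  have "continuous_on S (\<lambda>r. f (z + r *\<^sub>R b))" "continuous_on S (\<lambda>r. f' (z + r *\<^sub>R b) b)"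
    using assms(3) by (auto intro!: continuous_on_compose2[OF continuous_on_f line]
        continuous_on_compose2[OF cont[OF assms(2)] line])
  moreover from this(1) have "continuous_on S (\<lambda>r. \<bar>f (z + r *\<^sub>R b)\<bar> powr (s - 1) * sgn (f (z + r *\<^sub>R b)))"
    using assms(1) by (intro continuous_on_compose2[OF continuous_on_abs_powr_sgn]) auto
  ultimately show ?thesis by (intro continuous_on_mult[OF continuous_on_mult[OF continuous_on_const]])
qed

lemma power_deriv_le_power_energy:
  assumes "1 < s" "b \<in> Basis" "0 < snd w"
  shows "ennreal (snd w powr \<alpha> * \<bar>s * (\<bar>f w\<bar> powr (s - 1) * sgn (f w)) * f' w b\<bar>) \<le> power_energy s w"
proof -
  have "\<bar>s * (\<bar>f w\<bar> powr (s - 1) * sgn (f w)) * f' w b\<bar> \<le> s * (\<bar>f w\<bar> powr (s - 1) * grad_norm w)"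
    using assms(1) abs_partial_le_grad_norm[OF assms(2), of w]
    by (auto simp: abs_mult abs_sgn_eq intro!: mult_mono)
  from mult_left_mono[OF this, of "snd w powr \<alpha>"] show ?thesis
    using assms by (auto simp: power_energy_def ac_simps intro!: ennreal_leI)
qed

lemma vertical_line:
  assumes s: "1 < s"
  shows "\<And>t. 0 < t \<Longrightarrow> ennreal (t powr \<alpha> * \<bar>f (x, t)\<bar> powr s) \<le> (\<integral>\<^sup>+r. power_energy s (x, r) \<partial>lborel)"
    and "ennreal \<bar>\<alpha>\<bar> * (\<integral>\<^sup>+t\<in>{0<..}. ennreal (t powr (\<alpha> - 1) * \<bar>f (x, t)\<bar> powr s) \<partial>lborel)
      \<le> (\<integral>\<^sup>+r. power_energy s (x, r) \<partial>lborel)"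
proof -
  define g' where "g' r = s * (\<bar>f (x, r)\<bar> powr (s - 1) * sgn (f (x, r))) * f' (x, r) (0, 1)" for r
  have b: "(0, 1) \<in> (Basis :: ('a \<times> real) set)" by (simp add: Basis_prod_def)
  have 1: "((\<lambda>r. \<bar>f (x, r)\<bar> powr s) has_real_derivative g' t) (at t)" if "0 < t" for t
    using power_deriv_line[OF s, of "(x, 0)" t "(0, 1)"] that by (simp add: g'_def)
  have 2: "continuous_on {0<..} g'"
    using continuous_on_power_deriv_line[OF s b, of "{0<..}" "(x, 0)"] by (simp add: g'_def[abs_def])
  have 3: "\<bar>f (x, r)\<bar> powr s = 0" if "\<bar>R\<bar> + 1 \<le> r" for r
    using that norm_snd_le[of r x] supp[of "(x, r)"] by simp
  have 4: "0 \<le> \<alpha> \<or> 0 < \<epsilon> \<and> (\<forall>r<\<epsilon>. \<bar>f (x, r)\<bar> powr s = 0)"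
    using sign by auto
  have le: "(\<integral>\<^sup>+r\<in>{0<..}. ennreal (r powr \<alpha> * \<bar>g' r\<bar>) \<partial>lborel) \<le> (\<integral>\<^sup>+r. power_energy s (x, r) \<partial>lborel)"
    using power_deriv_le_power_energy[OF s b]
    by (intro nn_integral_mono) (force simp: g'_def indicator_def)
  note hardy = weighted_hardy_halfline[where g = "\<lambda>r. \<bar>f (x, r)\<bar> powr s", OF 1 2 _ 3 4]
  show "ennreal (t powr \<alpha> * \<bar>f (x, t)\<bar> powr s) \<le> (\<integral>\<^sup>+r. power_energy s (x, r) \<partial>lborel)" if "0 < t" for t
    by (rule order_trans[OF hardy(1)[OF _ _ _ that] le]) auto
  show "ennreal \<bar>\<alpha>\<bar> * (\<integral>\<^sup>+t\<in>{0<..}. ennreal (t powr (\<alpha> - 1) * \<bar>f (x, t)\<bar> powr s) \<partial>lborel)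
      \<le> (\<integral>\<^sup>+r. power_energy s (x, r) \<partial>lborel)"
    by (rule order_trans[OF hardy(2) le]) auto
qed

lemma weighted_hardy:
  assumes s: "1 < s"
  shows "ennreal \<bar>\<alpha>\<bar> * (\<integral>\<^sup>+z\<in>half_space. ennreal (snd z powr (\<alpha> - 1) * \<bar>f z\<bar> powr s) \<partial>lborel)
    \<le> (\<integral>\<^sup>+z. power_energy s z \<partial>lborel)"
proof -
  note [measurable] = measurable_power_energy[OF s]
  define F where "F z = ennreal (snd z powr (\<alpha> - 1) * \<bar>f z\<bar> powr s) * indicator half_space z" for z
  have [measurable]: "F \<in> borel_measurable borel"
    unfolding F_def[abs_def] using s by (intro measurable_weighted_power) auto
  have "ennreal \<bar>\<alpha>\<bar> * (\<integral>\<^sup>+z. F z \<partial>lborel)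
    = (\<integral>\<^sup>+x. ennreal \<bar>\<alpha>\<bar> * (\<integral>\<^sup>+t. F (x, t) \<partial>lborel) \<partial>lborel)"
    by (simp add: nn_integral_lborel_pair nn_integral_cmult)
  also have "\<dots> \<le> (\<integral>\<^sup>+x. \<integral>\<^sup>+t. power_energy s (x, t) \<partial>lborel \<partial>lborel)"
    using vertical_line(2)[OF s]
    by (intro nn_integral_mono) (simp add: F_def indicator_def)
  also have "\<dots> = (\<integral>\<^sup>+z. power_energy s z \<partial>lborel)"
    by (simp add: nn_integral_lborel_pair)
  finally show ?thesis by (simp add: F_def)
qed

text \<open>In horizontal directions the weight is constant and the fundamental theorem of calculus is
  enough. In the vertical direction the derivative of the weight would contribute as well, but the
  one-dimensional estimate disposes of it because of its sign.\<close>

lemma le_line_integral_power_energy: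
  assumes s: "1 < s" and b: "b \<in> Basis" and z: "z \<in> half_space"
  shows "ennreal (snd z powr \<alpha> * \<bar>f z\<bar> powr s) \<le> line_integral b (power_energy s) z"
proof -
  note [measurable] = measurable_power_energy[OF s]
  obtain x t where xt: "z = (x, t)" "0 < t" using z by (cases z) auto
  from b consider "b = (0, 1)" | i where "b = (i, 0)" "i \<in> Basis"
    by (auto simp: Basis_prod_def)
  then show ?thesis
  proof cases
    case 1
    have "(\<integral>\<^sup>+r. power_energy s (x, r) \<partial>lborel) = line_integral b (power_energy s) z"
      unfolding line_integral_def using xt 1
      by (subst nn_integral_real_affine[where c = 1 and t = t]) (simp_all add: add.commute)
    with vertical_line(1)[OF s, of t x] xt show ?thesis by simp
  next
    case 2
    have norm_b: "norm b = 1" using b by simp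
    define g' where "g' r = s * (\<bar>f (z + r *\<^sub>R b)\<bar> powr (s - 1) * sgn (f (z + r *\<^sub>R b)))
      * f' (z + r *\<^sub>R b) b" for r
    define c where "c = \<bar>R\<bar> + norm z + 1"
    have H: "snd (z + r *\<^sub>R b) = t" for r using 2 xt by simp
    have Hs: "z + r *\<^sub>R b \<in> half_space" for r using 2 xt by simp
    have "0 \<le> c" by (simp add: c_def)
    have "norm ((- c) *\<^sub>R b) - norm z \<le> norm (z + (- c) *\<^sub>R b)"
      by (metis add.commute norm_diff_ineq)
    then have f0: "f (z + (- c) *\<^sub>R b) = 0"
      using norm_b by (intro supp) (simp add: c_def)
    have cont_g': "continuous_on UNIV g'"
      unfolding g'_def[abs_def] by (intro continuous_on_power_deriv_line s b Hs)
    then have [measurable]: "g' \<in> borel_measurable borel" by (rule borel_measurable_continuous_onI)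
    have "ennreal \<bar>\<bar>f (z + 0 *\<^sub>R b)\<bar> powr s - \<bar>f (z + (- c) *\<^sub>R b)\<bar> powr s\<bar>
      \<le> (\<integral>\<^sup>+r\<in>{-c..0}. ennreal \<bar>g' r\<bar> \<partial>lborel)"
    proof (rule abs_derivative_nn_integral_ge)
      show "continuous_on {-c..0} g'"
        using cont_g' by (rule continuous_on_subset) simp
    qed (use \<open>0 \<le> c\<close> in \<open>auto simp only: g'_def intro!: power_deriv_line s Hs\<close>)
    then have "ennreal (\<bar>f z\<bar> powr s) \<le> (\<integral>\<^sup>+r\<in>{-c..0}. ennreal \<bar>g' r\<bar> \<partial>lborel)"
      using f0 s by simp
    then have "ennreal (t powr \<alpha>) * ennreal (\<bar>f z\<bar> powr s)
      \<le> ennreal (t powr \<alpha>) * (\<integral>\<^sup>+r\<in>{-c..0}. ennreal \<bar>g' r\<bar> \<partial>lborel)"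
      by (rule mult_left_mono) simp
    also have "\<dots> = (\<integral>\<^sup>+r. ennreal (t powr \<alpha>) * (ennreal \<bar>g' r\<bar> * indicator {-c..0} r) \<partial>lborel)"
      by (rule nn_integral_cmult[symmetric]) measurable
    also have "\<dots> \<le> line_integral b (power_energy s) z"
      unfolding line_integral_def
    proof (intro nn_integral_mono)
      fix r
      have "ennreal (t powr \<alpha>) * ennreal \<bar>g' r\<bar> \<le> power_energy s (z + r *\<^sub>R b)"
        using power_deriv_le_power_energy[OF s b, of "z + r *\<^sub>R b", unfolded H, OF xt(2)]
        by (simp add: g'_def ennreal_mult)
      then show "ennreal (t powr \<alpha>) * (ennreal \<bar>g' r\<bar> * indicator {-c..0} r)
        \<le> power_energy s (z + r *\<^sub>R b)"
        by (auto simp: indicator_def)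
    qed
    finally show ?thesis using xt by (simp add: ennreal_mult)
  qed
qed

lemma weighted_gagliardo_nirenberg:
  assumes s: "1 < s" and r: "r = (DIM('a) + 1) / DIM('a)"
  shows "(\<integral>\<^sup>+z\<in>half_space. ennreal ((snd z powr \<alpha> * \<bar>f z\<bar> powr s) powr r) \<partial>lborel)
    \<le> ennreal_powr (\<integral>\<^sup>+z. power_energy s z \<partial>lborel) r"
proof -
  define u where "u z = ennreal (snd z powr \<alpha> * \<bar>f z\<bar> powr s) * indicator half_space z" for z
  have "(\<integral>\<^sup>+z\<in>half_space. ennreal ((snd z powr \<alpha> * \<bar>f z\<bar> powr s) powr r) \<partial>lborel)
    = (\<integral>\<^sup>+z. ennreal_powr (u z) r \<partial>lborel)"
    by (intro nn_integral_cong) (simp add: u_def indicator_def)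
  also have "\<dots> \<le> ennreal_powr (\<integral>\<^sup>+z. power_energy s z \<partial>lborel) r"
  proof (rule Gagliardo_Nirenberg)
    show "u z \<le> line_integral b (power_energy s) z" if "b \<in> Basis" for b z
      using le_line_integral_power_energy[OF s that, of z] by (simp add: u_def indicator_def)
    show "2 \<le> DIM('a \<times> real)" using DIM_positive[where 'a = 'a] by simp
    show "r = real DIM('a \<times> real) / (real DIM('a \<times> real) - 1)" by (simp add: r)
  qed (rule measurable_power_energy[OF s])
  finally show ?thesis .
qed

section \<open>Interpolation\<close>

text \<open>On the support of \<open>f\<close> the weight is bounded, since either \<open>\<alpha> \<ge> 0\<close> or the support stays away
  from the boundary.\<close>

lemma power_energy_finite:
  assumes "1 < s" and bound: "\<And>z. z \<in> half_space \<Longrightarrow> \<bar>f z\<bar> \<le> M \<and> grad_norm z \<le> M"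
  shows "(\<integral>\<^sup>+z. power_energy s z \<partial>lborel) < top"
proof -
  define c where "c = (if 0 \<le> \<alpha> then R powr \<alpha> else \<epsilon> powr \<alpha>)"
  have "power_energy s z \<le> ennreal (s * (c * (M powr (s - 1) * M))) * indicator (cball 0 R) z" for z
  proof (cases "z \<in> half_space \<and> f z \<noteq> 0")
    case True
    then have "norm z \<le> R" using supp[of z] by force
    moreover have t: "0 < snd z" "snd z \<le> norm z" using True norm_snd_le[of "snd z" "fst z"] by auto
    moreover have "\<epsilon> \<le> snd z" "0 < \<epsilon>" if "\<not> 0 \<le> \<alpha>"
      using sign True that by (meson leI)+
    ultimately have "snd z powr \<alpha> \<le> c"
      by (cases "0 \<le> \<alpha>") (simp_all add: c_def powr_mono2 powr_mono2')
    then have "s * (snd z powr \<alpha> * (\<bar>f z\<bar> powr (s - 1) * grad_norm z)) \<le> s * (c * (M powr (s - 1) * M))"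
      using assms(1) bound[of z] True
      by (intro mult_mono mult_left_mono mult_nonneg_nonneg powr_mono2) (auto simp: c_def)
    with \<open>norm z \<le> R\<close> True show ?thesis by (simp add: power_energy_def ennreal_leI)
  qed (auto simp: power_energy_def)
  then have "(\<integral>\<^sup>+z. power_energy s z \<partial>lborel)
    \<le> (\<integral>\<^sup>+z. ennreal (s * (c * (M powr (s - 1) * M))) * indicator (cball 0 R :: ('a \<times> real) set) z \<partial>lborel)"
    by (intro nn_integral_mono) auto
  also have "\<dots> < top"
    using emeasure_lborel_cball_finite[of "0 :: 'a \<times> real" R]
    by (simp add: nn_integral_cmult_indicator ennreal_mult_less_top)
  finally show ?thesis .
qed

text \<open>Hoelder's inequality between the Hardy and the Gagliardo-Nirenberg inequality for
  \<open>\<bar>f\<bar> powr s\<close>. The homogeneity in \<open>f\<close> and the exponent of the weight determine \<open>\<theta>\<close> and \<open>\<beta>\<close>. The Hardy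
  inequality is void for \<open>\<alpha> = 0\<close>, so that \<open>\<theta> = 1\<close> is then required. The end cases \<open>\<theta> = 0\<close> and
  \<open>\<theta> = 1\<close> are separate because an infinite or vanishing integral raised to the power 0 has no
  sensible value.\<close>

lemma weighted_interpolation:
  fixes Q s q \<theta> \<beta> K :: real
  assumes Q: "2 \<le> Q" and s: "s = Q / 2 + 1" and q: "q = Q / s"
    and \<theta>: "\<theta> = DIM('a) * (q - 1)" "\<theta> \<le> 1" and nondeg: "\<alpha> \<noteq> 0 \<or> \<theta> = 1"
    and \<beta>: "\<beta> = \<alpha> * q - (1 - \<theta>)"
    and K: "K = (if \<alpha> = 0 then 1 else \<bar>\<alpha>\<bar> powr (\<theta> - 1))"
  shows "(\<integral>\<^sup>+z\<in>half_space. ennreal (snd z powr \<beta> * \<bar>f z\<bar> powr Q) \<partial>lborel)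
    \<le> ennreal K * ennreal_powr (\<integral>\<^sup>+z. power_energy s z \<partial>lborel) q"
    (is "?X \<le> _ * ennreal_powr ?Y q")
proof -
  define r where "r = (DIM('a) + 1) / real DIM('a)"
  define g where "g z = ennreal (snd z powr (\<alpha> - 1) * \<bar>f z\<bar> powr s) * indicator half_space z" for z
  define h where "h z = ennreal ((snd z powr \<alpha> * \<bar>f z\<bar> powr s) powr r) * indicator half_space z" for z
  have s1: "1 < s" and q1: "1 \<le> q" using Q by (auto simp: s q field_simps)
  then have \<theta>0: "0 \<le> \<theta>" by (simp add: \<theta>)
  have \<theta>r: "\<theta> * r = \<theta> + q - 1" by (simp add: \<theta> r_def field_simps)
  have real: "snd z powr \<beta> * \<bar>f z\<bar> powr Q
    = (snd z powr (\<alpha> - 1) * \<bar>f z\<bar> powr s) powr (1 - \<theta>) * ((snd z powr \<alpha> * \<bar>f z\<bar> powr s) powr r) powr \<theta>"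
    if "0 < snd z" for z
  proof (cases "f z = 0")
    case False
    have "(\<alpha> - 1) * (1 - \<theta>) + \<alpha> * (\<theta> * r) = \<beta>" "s * (1 - \<theta>) + s * (\<theta> * r) = Q"
      using s1 by (simp_all add: \<theta>r \<beta> q algebra_simps)
    then have "snd z powr \<beta> * \<bar>f z\<bar> powr Q = snd z powr ((\<alpha> - 1) * (1 - \<theta>) + \<alpha> * (\<theta> * r))
        * \<bar>f z\<bar> powr (s * (1 - \<theta>) + s * (\<theta> * r))" by simp
    then show ?thesis
      using that by (simp add: powr_mult powr_powr powr_add ac_simps)
  qed (use s1 in simp)
  have \<theta>_cases: "\<theta> = 0 \<or> \<theta> = 1 \<or> 0 < \<theta> \<and> \<theta> < 1" using \<theta>0 \<theta>(2) by linarith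
  have [measurable]: "g \<in> borel_measurable borel"
    unfolding g_def[abs_def] using s1 by (intro measurable_weighted_power) auto
  have [measurable]: "h \<in> borel_measurable borel"
  proof -
    have "(snd z powr \<alpha> * \<bar>f z\<bar> powr s) powr r = snd z powr (\<alpha> * r) * \<bar>f z\<bar> powr (s * r)"
      if "0 < snd z" for z
      using that by (simp add: powr_mult powr_powr)
    then have "h = (\<lambda>z. ennreal (snd z powr (\<alpha> * r) * \<bar>f z\<bar> powr (s * r)) * indicator half_space z)"
      by (auto simp: h_def fun_eq_iff indicator_def)
    also have "\<dots> \<in> borel_measurable borel"
      using s1 by (intro measurable_weighted_power) (auto simp: r_def)
    finally show ?thesis .
  qed
  have hardy: "ennreal \<bar>\<alpha>\<bar> * (\<integral>\<^sup>+z. g z \<partial>lborel) \<le> ?Y"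
    using weighted_hardy[OF s1] by (simp add: g_def)
  have gn: "(\<integral>\<^sup>+z. h z \<partial>lborel) \<le> ennreal_powr ?Y r"
    using weighted_gagliardo_nirenberg[OF s1 r_def] by (simp add: h_def)
  have G: "(\<integral>\<^sup>+z. g z \<partial>lborel) \<le> ennreal (1 / \<bar>\<alpha>\<bar>) * ?Y" if "\<alpha> \<noteq> 0"
  proof -
    have "ennreal (1 / \<bar>\<alpha>\<bar>) * (ennreal \<bar>\<alpha>\<bar> * (\<integral>\<^sup>+z. g z \<partial>lborel)) = (\<integral>\<^sup>+z. g z \<partial>lborel)"
      using that by (simp add: mult.assoc[symmetric] flip: ennreal_mult)
    then show ?thesis using mult_left_mono[OF hardy, of "ennreal (1 / \<bar>\<alpha>\<bar>)"] by simp
  qed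
  from \<theta>_cases consider "\<theta> = 0" | "\<theta> = 1" | "0 < \<theta>" "\<theta> < 1" by blast
  then show ?thesis
  proof cases
    case 1
    have "?X = (\<integral>\<^sup>+z. g z \<partial>lborel)"
    proof (intro nn_integral_cong)
      fix z
      show "ennreal (snd z powr \<beta> * \<bar>f z\<bar> powr Q) * indicator half_space z = g z"
        using real[of z] 1 s1 by (cases "f z = 0") (auto simp: g_def indicator_def)
    qed
    moreover have "q = 1" using \<theta> 1 by simp
    ultimately show ?thesis using G nondeg 1 K by (simp add: powr_minus_divide)
  next
    case 2
    have "?X = (\<integral>\<^sup>+z. h z \<partial>lborel)"
    proof (intro nn_integral_cong)
      fix z
      show "ennreal (snd z powr \<beta> * \<bar>f z\<bar> powr Q) * indicator half_space z = h z"
        using real[of z] 2 s1 by (cases "f z = 0") (auto simp: h_def indicator_def)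
    qed
    moreover have "q = r" using \<theta>r 2 by simp
    moreover have "K = 1" using K 2 by (cases "\<alpha> = 0") simp_all
    ultimately show ?thesis using gn by simp
  next
    case 3
    then have \<alpha>: "\<alpha> \<noteq> 0" using nondeg by simp
    have c: "(1 / \<bar>\<alpha>\<bar>) powr (1 - \<theta>) = \<bar>\<alpha>\<bar> powr (\<theta> - 1)"
      using powr_minus_divide[of "\<bar>\<alpha>\<bar>" "1 - \<theta>"] by (simp add: powr_divide)
    have "?X = (\<integral>\<^sup>+z. ennreal_powr (g z) (1 - \<theta>) * ennreal_powr (h z) \<theta> \<partial>lborel)"
      by (intro nn_integral_cong) (simp add: g_def h_def indicator_def real flip: ennreal_mult)
    also have "\<dots> \<le> ennreal_powr (\<integral>\<^sup>+z. g z \<partial>lborel) (1 - \<theta>) * ennreal_powr (\<integral>\<^sup>+z. h z \<partial>lborel) \<theta>"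
      using 3 by (intro Hoelder_nn_integral) auto
    also have "\<dots> \<le> ennreal_powr (ennreal (1 / \<bar>\<alpha>\<bar>) * ?Y) (1 - \<theta>) * ennreal_powr (ennreal_powr ?Y r) \<theta>"
      using 3 G[OF \<alpha>] gn by (intro mult_mono ennreal_powr_mono) auto
    also have "\<dots> = ennreal (\<bar>\<alpha>\<bar> powr (\<theta> - 1)) * (ennreal_powr ?Y (1 - \<theta>) * ennreal_powr ?Y (\<theta> * r))"
      by (simp add: ennreal_powr_mult ennreal_powr_powr c ac_simps)
    also have "\<dots> = ennreal K * ennreal_powr ?Y q"
      using \<alpha> by (cases "?Y = 0") (auto simp: ennreal_powr_add K \<theta>r zero_less_iff_neq_zero)
    finally show ?thesis .
  qed
qed

text \<open>The choice \<open>s = Q / 2 + 1\<close> is made for this estimate: the gradient of \<open>\<bar>f\<bar> powr s\<close> has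
  \<open>s * \<bar>f\<bar> powr (Q / 2)\<close> times the length of that of \<open>f\<close>, and the square of \<open>\<bar>f\<bar> powr (Q / 2)\<close> is the
  power of \<open>f\<close> that is to be estimated.\<close>

lemma power_energy_cauchy_schwarz:
  assumes Q: "2 \<le> Q" and s: "s = Q / 2 + 1" and \<alpha>: "\<alpha> = \<beta> / 2 + a / 2"
  shows "ennreal_powr (\<integral>\<^sup>+z. power_energy s z \<partial>lborel) 2
    \<le> ennreal (s\<^sup>2) * (\<integral>\<^sup>+z\<in>half_space. ennreal (snd z powr \<beta> * \<bar>f z\<bar> powr Q) \<partial>lborel)
        * (\<integral>\<^sup>+z\<in>half_space. ennreal (snd z powr a * (grad_norm z)\<^sup>2) \<partial>lborel)"
proof -
  define g where "g z = ennreal (snd z powr \<beta> * \<bar>f z\<bar> powr Q) * indicator half_space z" for z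
  define h where "h z = ennreal (snd z powr a * (grad_norm z)\<^sup>2) * indicator half_space z" for z
  have s0: "0 < s" using Q by (simp add: s)
  have [measurable]: "g \<in> borel_measurable borel"
    unfolding g_def[abs_def] using Q by (intro measurable_weighted_power) auto
  have [measurable]: "h \<in> borel_measurable borel"
    unfolding h_def[abs_def]
    by (intro measurable_half_space continuous_on_mult continuous_on_powr' continuous_on_power
      continuous_on_const continuous_on_snd continuous_on_id continuous_on_grad_norm) auto
  have "power_energy s z = ennreal s * (ennreal_powr (g z) (1 - 1/2) * ennreal_powr (h z) (1/2))" for z
  proof (cases "0 < snd z")
    case True
    have "((grad_norm z)\<^sup>2) powr (1 / 2) = grad_norm z" by (simp add: powr_half_sqrt)
    moreover have "snd z powr \<alpha> = snd z powr (\<beta> / 2) * snd z powr (a / 2)"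
      by (simp add: \<alpha> powr_add)
    ultimately show ?thesis
      using True s0 by (simp add: power_energy_def g_def h_def powr_mult powr_powr s ac_simps
        flip: ennreal_mult)
  qed (simp add: power_energy_def g_def h_def)
  then have "(\<integral>\<^sup>+z. power_energy s z \<partial>lborel)
    = ennreal s * (\<integral>\<^sup>+z. ennreal_powr (g z) (1 - 1/2) * ennreal_powr (h z) (1/2) \<partial>lborel)"
    by (simp add: nn_integral_cmult)
  also have "\<dots> \<le> ennreal s * (ennreal_powr (\<integral>\<^sup>+z. g z \<partial>lborel) (1 - 1/2) *
      ennreal_powr (\<integral>\<^sup>+z. h z \<partial>lborel) (1/2))"
    by (intro mult_left_mono Hoelder_nn_integral) auto
  finally have "ennreal_powr (\<integral>\<^sup>+z. power_energy s z \<partial>lborel) 2 \<le> ennreal_powr \<dots> 2"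
    by (rule ennreal_powr_mono) simp
  also have "\<dots> = ennreal (s\<^sup>2) * (\<integral>\<^sup>+z. g z \<partial>lborel) * (\<integral>\<^sup>+z. h z \<partial>lborel)"
    using s0 by (simp add: ennreal_powr_mult ennreal_powr_powr mult.assoc)
  finally show ?thesis by (simp add: g_def h_def)
qed

text \<open>Interpolation and the Cauchy-Schwarz inequality together bound \<open>X powr (2 / q)\<close> by a multiple of
  \<open>X\<close> times the energy, where \<open>X\<close> is the weighted integral of \<open>\<bar>f\<bar> powr Q\<close>. Since
  \<open>2 / q = 2 / Q + 1\<close>, one factor \<open>X\<close> cancels. This requires \<open>X\<close> to be finite, which the
  interpolation inequality itself provides.\<close>

theorem weighted_sobolev:
  fixes Q s q \<theta> \<beta> a K M :: real
  assumes Q: "2 \<le> Q" and s: "s = Q / 2 + 1" and q: "q = Q / s"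
    and \<theta>: "\<theta> = DIM('a) * (q - 1)" "\<theta> \<le> 1" and nondeg: "\<alpha> \<noteq> 0 \<or> \<theta> = 1"
    and \<alpha>: "\<alpha> = \<beta> / 2 + a / 2" and \<beta>: "\<beta> = \<alpha> * q - (1 - \<theta>)"
    and K: "K = (if \<alpha> = 0 then 1 else \<bar>\<alpha>\<bar> powr (\<theta> - 1))"
    and bound: "\<And>z. z \<in> half_space \<Longrightarrow> \<bar>f z\<bar> \<le> M \<and> grad_norm z \<le> M"
  shows "ennreal_powr (\<integral>\<^sup>+z\<in>half_space. ennreal (snd z powr \<beta> * \<bar>f z\<bar> powr Q) \<partial>lborel) (2 / Q)
    \<le> ennreal (K powr (2 / q) * s\<^sup>2)
        * (\<integral>\<^sup>+z\<in>half_space. ennreal (snd z powr a * (grad_norm z)\<^sup>2) \<partial>lborel)"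
    (is "ennreal_powr ?X _ \<le> _ * ?E")
proof (cases "?X = 0")
  case False
  let ?Y = "\<integral>\<^sup>+z. power_energy s z \<partial>lborel"
  have s1: "1 < s" and q1: "1 \<le> q" using Q by (auto simp: s q field_simps)
  have K0: "0 \<le> K" by (simp add: K)
  have X: "?X \<le> ennreal K * ennreal_powr ?Y q"
    by (rule weighted_interpolation[OF Q s q \<theta> nondeg \<beta> K])
  also have "ennreal_powr ?Y q < top"
    using power_energy_finite[OF s1 bound] by (metis ennreal_powr_eq_top_iff less_top)
  then have "ennreal K * ennreal_powr ?Y q < top"
    by (simp add: ennreal_mult_less_top)
  finally have top: "?X \<noteq> top" by simp
  have "2 / q = 2 / Q + 1" using Q by (simp add: q s field_simps)
  then have "?X * ennreal_powr ?X (2 / Q) = ennreal_powr ?X (2 / q)"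
    using False ennreal_powr_add[of ?X "2 / Q" 1] by (simp add: zero_less_iff_neq_zero mult.commute)
  also have "\<dots> \<le> ennreal_powr (ennreal K * ennreal_powr ?Y q) (2 / q)"
    using q1 by (intro ennreal_powr_mono X) simp
  also have "\<dots> = ennreal (K powr (2 / q)) * ennreal_powr ?Y 2"
    using q1 K0 by (simp add: ennreal_powr_mult ennreal_powr_powr)
  also have "\<dots> \<le> ennreal (K powr (2 / q)) * (ennreal (s\<^sup>2) * ?X * ?E)"
    by (intro mult_left_mono power_energy_cauchy_schwarz[OF Q s \<alpha>]) simp
  also have "\<dots> = ?X * (ennreal (K powr (2 / q) * s\<^sup>2) * ?E)"
    by (simp add: ennreal_mult ac_simps)
  finally show ?thesis
    using False top by (simp add: ennreal_mult_le_mult_iff)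
qed simp

end

section \<open>Compactly supported smooth functions\<close>

lemma bounded_if_compact_support:
  fixes g :: "'a::topological_space \<Rightarrow> real"
  assumes "compact S" "S \<subseteq> U" "continuous_on U g" "\<And>z. z \<notin> S \<Longrightarrow> g z = 0"
  obtains M where "\<And>z. \<bar>g z\<bar> \<le> M"
proof -
  have "bounded (g ` S)"
    by (rule compact_imp_bounded[OF compact_continuous_image[OF continuous_on_subset[OF assms(3,2)] assms(1)]])
  then obtain M where M: "\<And>z. z \<in> S \<Longrightarrow> \<bar>g z\<bar> \<le> M" by (auto simp: bounded_real)
  have "\<bar>g z\<bar> \<le> max 0 M" for z using M[of z] assms(4)[of z] by (cases "z \<in> S") auto
  then show ?thesis by (rule that)
qed

lemma C0_infinity_imp_half_space_function:
  fixes f :: "'a::euclidean_space \<times> real \<Rightarrow> real"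
  assumes f: "f \<in> C0_infinity U" and U: "half_space \<subseteq> U" and sign: "0 \<le> \<alpha> \<or> U = half_space"
  obtains R \<epsilon> M where "half_space_function f (\<lambda>z. frechet_derivative f (at z)) \<alpha> R \<epsilon>"
    and "\<And>z. \<bar>f z\<bar> \<le> M"
    and "\<And>z. half_space_function.grad_norm (\<lambda>z. frechet_derivative f (at z)) z \<le> M"
proof -
  define S where "S = closure (support_on UNIV f)"
  have S: "compact S" "S \<subseteq> U" using f by (auto simp: C0_infinity_def S_def)
  have f0: "f z = 0" if "z \<notin> S" for z
    using that closure_subset[of "support_on UNIV f"] by (auto simp: S_def in_support_on)
  have "Ck_on (Suc 0) U f" using f by (simp add: C0_infinity_def smooth_on_def del: Ck_on.simps)
  then have diff: "\<And>z. z \<in> U \<Longrightarrow> f differentiable (at z)"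
    and cont_df: "\<And>v. continuous_on U (\<lambda>z. frechet_derivative f (at z) v)"
    by (simp_all only: Ck_on.simps)
  have contf: "continuous_on U f"
    using diff by (auto intro!: continuous_at_imp_continuous_on differentiable_imp_continuous_within)
  have df0: "frechet_derivative f (at z) v = 0" if "z \<notin> S" for z v
  proof -
    have "(f has_derivative (\<lambda>_. 0)) (at z)"
    proof (rule has_derivative_transform_within_open[where s = "- S"])
      show "((\<lambda>_. 0) has_derivative (\<lambda>_. 0)) (at z)" by simp
      show "open (- S)" using S(1) by (simp add: compact_imp_closed open_Compl)
    qed (use that f0 in auto)
    then have "(\<lambda>_. 0) = frechet_derivative f (at z)" by (rule frechet_derivative_at)
    then show ?thesis by (metis)
  qed
  obtain R where R: "\<And>z. z \<in> S \<Longrightarrow> norm z \<le> R"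
    using compact_imp_bounded[OF S(1)] by (auto simp: bounded_iff)
  \<comment> \<open>If \<open>U\<close> is the half-space, the last coordinate has a positive minimum on the support.\<close>
  obtain \<epsilon> where \<epsilon>: "0 \<le> \<alpha> \<or> 0 < \<epsilon> \<and> (\<forall>z. snd z < \<epsilon> \<longrightarrow> f z = 0)"
  proof (cases "0 \<le> \<alpha> \<or> S = {}")
    case True
    then show ?thesis using f0 that[of 1] by auto
  next
    case False
    have "continuous_on S snd" by (intro continuous_on_snd continuous_on_id)
    with False obtain z where z: "z \<in> S" "\<And>y. y \<in> S \<Longrightarrow> snd z \<le> snd y"
      using continuous_attains_inf[OF S(1)] by blast
    show ?thesis
    proof (rule that[of "snd z"], intro disjI2 conjI allI impI)
      show "0 < snd z" using z(1) S(2) sign False by auto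
      show "f y = 0" if "snd y < snd z" for y using z(2)[of y] that by (intro f0) auto
    qed
  qed
  interpret half_space_function f "\<lambda>z. frechet_derivative f (at z)" \<alpha> R \<epsilon>
  proof
    show "(f has_derivative frechet_derivative f (at z)) (at z)" if "z \<in> half_space" for z
      using diff[OF subsetD[OF U that]] by (simp add: frechet_derivative_works)
    show "continuous_on half_space (\<lambda>z. frechet_derivative f (at z) b)" for b
      using cont_df U by (rule continuous_on_subset)
    show "f z = 0" if "R < norm z" for z using that R[of z] by (intro f0) auto
  qed (rule \<epsilon>)
  have "continuous_on U grad_norm"
    unfolding grad_norm_def[abs_def] by (intro continuous_intros cont_df)
  moreover have "grad_norm z = 0" if "z \<notin> S" for z using df0[OF that] by (simp add: grad_norm_def)
  ultimately obtain M1 where M1: "\<And>z. \<bar>grad_norm z\<bar> \<le> M1"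
    using bounded_if_compact_support[OF S] by blast
  obtain M2 where M2: "\<And>z. \<bar>f z\<bar> \<le> M2"
    using bounded_if_compact_support[OF S contf f0] by blast
  show ?thesis
  proof (rule that)
    show "half_space_function f (\<lambda>z. frechet_derivative f (at z)) \<alpha> R \<epsilon>"
      by (rule half_space_function_axioms)
    show "\<bar>f z\<bar> \<le> max M1 M2" for z using M2[of z] by simp
    show "grad_norm z \<le> max M1 M2" for z using M1[of z] by simp
  qed
qed

lemma sum_Basis_times_real:
  "(\<Sum>b\<in>(Basis :: ('a::euclidean_space \<times> real) set). F b) = (\<Sum>b\<in>Basis. F (b, 0)) + F (0, 1)"
proof -
  let ?E = "(\<lambda>b. (b, 0 :: real)) ` (Basis :: 'a set)"
  have "(Basis :: ('a \<times> real) set) = insert (0, 1) ?E"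
    by (auto simp: Basis_prod_def)
  then have "sum F Basis = sum F (insert (0, 1) ?E)"
    by (rule arg_cong)
  also have "\<dots> = F (0, 1) + sum F ?E"
    by (rule sum.insert) auto
  also have "sum F ?E = (\<Sum>b\<in>Basis. F (b, 0))"
    by (simp add: sum.reindex inj_on_def)
  finally show ?thesis by (simp add: add.commute)
qed

lemma sum_Basis_vec: "(\<Sum>b\<in>(Basis :: (real ^ 'n::finite) set). F b) = (\<Sum>i\<in>UNIV. F (axis i 1))"
proof -
  have "(Basis :: (real ^ 'n) set) = (\<lambda>i. axis i 1) ` UNIV" by (auto simp: Basis_vec_def)
  then have "sum F Basis = sum F ((\<lambda>i. axis i 1) ` UNIV)"
    by (rule arg_cong)
  also have "\<dots> = (\<Sum>i\<in>UNIV. F (axis i 1))"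
    by (simp add: sum.reindex inj_on_def axis_eq_axis)
  finally show ?thesis .
qed

lemma partial_gradients:
  fixes f :: "(real ^ 'n::finite) \<times> real \<Rightarrow> real"
  assumes f: "f differentiable (at (x, t))"
  shows "(norm (grad (\<lambda>y. f (y, t)) x))\<^sup>2 + (deriv (\<lambda>s. f (x, s)) t)\<^sup>2
    = (\<Sum>b\<in>Basis. (frechet_derivative f (at (x, t)) b)\<^sup>2)"
proof -
  let ?D = "frechet_derivative f (at (x, t))"
  have D: "(f has_derivative ?D) (at (x, t))" using f by (simp add: frechet_derivative_works)
  have 1: "((\<lambda>y. f (y, t)) has_derivative (\<lambda>h. ?D (h, 0))) (at x)"
    by (rule has_derivative_compose[where f = "\<lambda>y. (y, t)" and g = f, OF _ D])
       (auto intro!: derivative_eq_intros)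
  have 2: "((\<lambda>s. f (x, s)) has_derivative (\<lambda>h. ?D (0, h))) (at t)"
    by (rule has_derivative_compose[where f = "\<lambda>s. (x, s)" and g = f, OF _ D])
       (auto intro!: derivative_eq_intros)
  have "(\<lambda>h. ?D (0, h)) = (*) (?D (0, 1))"
  proof
    show "?D (0, h) = ?D (0, 1) * h" for h
      using linear_scale[OF has_derivative_linear[OF D], of h "(0, 1)"] by (simp add: mult.commute)
  qed
  with 2 have "((\<lambda>s. f (x, s)) has_real_derivative ?D (0, 1)) (at t)"
    by (simp only: has_field_derivative_def)
  then have "deriv (\<lambda>s. f (x, s)) t = ?D (0, 1)" by (rule DERIV_imp_deriv)
  moreover have "(norm (grad (\<lambda>y. f (y, t)) x))\<^sup>2 = (\<Sum>i\<in>UNIV. (?D (axis i 1, 0))\<^sup>2)"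
    using frechet_derivative_at[OF 1, symmetric]
    by (simp add: norm_vec_def L2_set_def sum_nonneg grad_def)
  ultimately show ?thesis by (simp add: sum_Basis_times_real sum_Basis_vec)
qed

section \<open>The weighted Sobolev inequality\<close>

theorem theorem1p4:
  fixes A B Q :: real and N :: nat
  assumes N: "N = CARD('n::finite) + 1"
    and params:
      "(N = 2 \<and> 2 \<le> Q \<and> B = A - 2 / Q) \<or>
       (N \<ge> 3 \<and> 2 \<le> Q \<and> Q \<le> 2 * real N / (real N - 2) \<and>
        B = A - 1 + (Q - 2) / (2 * Q) * real N)"
    and nondeg: "B * Q + 2 * A \<noteq> 0 \<or> (A = 0 \<and> B = 0)"
  shows "\<exists>C>0.
    (\<forall>f \<in> C0_infinity (half_space :: ((real ^ 'n) \<times> real) set).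
       ennreal_powr (weighted_power_integral (B * Q) Q f) (2 / Q)
         \<le> ennreal C * weighted_energy (2 * A) f) \<and>
    (B * Q + 2 * A > 0 \<or> (A = 0 \<and> B = 0) \<longrightarrow>
      (\<forall>f \<in> C0_infinity (UNIV :: ((real ^ 'n) \<times> real) set).
         ennreal_powr (weighted_power_integral (B * Q) Q f) (2 / Q)
           \<le> ennreal C * weighted_energy (2 * A) f))"
proof -
  define \<alpha> where "\<alpha> = (B * Q) / 2 + (2 * A) / 2"
  define s where "s = Q / 2 + 1"
  define q where "q = Q / s"
  define \<theta> where "\<theta> = real CARD('n) * (q - 1)"
  define K where "K = (if \<alpha> = 0 then 1 else \<bar>\<alpha>\<bar> powr (\<theta> - 1))"
  define C where "C = K powr (2 / q) * s\<^sup>2"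
  have Q: "2 \<le> Q" and n: "1 \<le> real CARD('n)" using params by (auto simp: Suc_le_eq)
  have q: "q = 2 * Q / (Q + 2)" using Q by (simp add: q_def s_def field_simps)
  then have q_minus_1: "q - 1 = (Q - 2) / (Q + 2)" using Q by (simp add: field_simps)
  \<comment> \<open>For \<open>N = 2\<close> the formula for \<open>N \<ge> 3\<close> reduces to \<open>A - 2 / Q\<close>.\<close>
  have B: "B = A - 1 + (Q - 2) / (2 * Q) * (real CARD('n) + 1)"
    using params Q N by (auto simp: field_simps)
  have \<theta>1: "\<theta> \<le> 1"
  proof -
    have "real CARD('n) * (Q - 2) \<le> Q + 2"
      using params
    proof
      assume "N = 2 \<and> 2 \<le> Q \<and> B = A - 2 / Q"
      then show ?thesis using N by simp
    next
      assume "3 \<le> N \<and> 2 \<le> Q \<and> Q \<le> 2 * real N / (real N - 2) \<and>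
        B = A - 1 + (Q - 2) / (2 * Q) * real N"
      then have "Q * (real N - 2) \<le> 2 * real N"
        using pos_le_divide_eq[of "real N - 2" Q "2 * real N"] by simp
      then show ?thesis using N by (simp add: algebra_simps)
    qed
    then show ?thesis using Q by (simp add: \<theta>_def q_minus_1)
  qed
  \<comment> \<open>The relation between \<open>A\<close>, \<open>B\<close> and \<open>Q\<close> is exactly what the interpolation demands of the weight.\<close>
  have scaling: "B * Q = \<alpha> * q - (1 - \<theta>)"
  proof -
    have b: "2 * (B * Q) = 2 * A * Q - Q - 2 + real CARD('n) * (Q - 2)"
      using Q by (simp add: B field_simps)
    have q_Q1: "q * (Q + 2) = 2 * Q" using Q by (simp add: q)
    then have q_Q2: "(q - 1) * (Q + 2) = Q - 2" by (simp add: left_diff_distrib)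
    have "(\<alpha> * q - (1 - \<theta>)) * (Q + 2)
      = \<alpha> * (q * (Q + 2)) - (Q + 2) + real CARD('n) * ((q - 1) * (Q + 2))"
      by (simp add: \<theta>_def algebra_simps)
    also have "\<dots> = (B * Q + 2 * A) * Q - (Q + 2) + real CARD('n) * (Q - 2)"
      unfolding q_Q1 q_Q2 by (simp add: \<alpha>_def algebra_simps)
    also have "\<dots> = B * Q * (Q + 2)" using b by (simp add: algebra_simps)
    finally show ?thesis using Q by simp
  qed
  \<comment> \<open>In the degenerate case \<open>A = B = 0\<close> the scaling relation forces the critical exponent.\<close>
  have crit: "\<alpha> \<noteq> 0 \<or> \<theta> = 1"
  proof (cases "\<alpha> = 0")
    case True
    then have "B * Q = 0" using nondeg by (auto simp: \<alpha>_def)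
    then show ?thesis using scaling True by simp
  qed simp
  have "0 < K" by (simp add: K_def)
  then have "0 < C" using Q by (simp add: C_def s_def)
  have main: "ennreal_powr (weighted_power_integral (B * Q) Q f) (2 / Q)
      \<le> ennreal C * weighted_energy (2 * A) f"
    if f: "f \<in> C0_infinity U" and U: "half_space \<subseteq> U" and sign: "0 \<le> \<alpha> \<or> U = half_space"
    for f and U :: "((real ^ 'n) \<times> real) set"
  proof -
    obtain R \<epsilon> M where hsf: "half_space_function f (\<lambda>z. frechet_derivative f (at z)) \<alpha> R \<epsilon>"
      and M: "\<And>z. \<bar>f z\<bar> \<le> M"
        "\<And>z. half_space_function.grad_norm (\<lambda>z. frechet_derivative f (at z)) z \<le> M"
      using C0_infinity_imp_half_space_function[OF f U sign] by blast
    interpret half_space_function f "\<lambda>z. frechet_derivative f (at z)" \<alpha> R \<epsilon> by (rule hsf)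
    have "weighted_energy (2 * A) f
      = (\<integral>\<^sup>+z\<in>half_space. ennreal (snd z powr (2 * A) * (grad_norm z)\<^sup>2) \<partial>lborel)"
      unfolding weighted_energy_def
    proof (intro nn_integral_cong)
      fix z :: "(real ^ 'n) \<times> real"
      obtain x t where z: "z = (x, t)" by (cases z)
      have "f differentiable (at (x, t))" if "0 < t"
        using deriv[of "(x, t)"] that by (auto simp: differentiable_def)
      then show "(case z of (x', t) \<Rightarrow> ennreal (t powr (2 * A) * ((norm (grad (\<lambda>y. f (y, t)) x'))\<^sup>2
            + (deriv (\<lambda>s. f (x', s)) t)\<^sup>2))) * indicator half_space z
        = ennreal (snd z powr (2 * A) * (grad_norm z)\<^sup>2) * indicator half_space z"
        using partial_gradients[of f x t]
        by (auto simp: z grad_norm_def sum_nonneg indicator_def)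
    qed
    moreover have "ennreal_powr (\<integral>\<^sup>+z\<in>half_space. ennreal (snd z powr (B * Q) * \<bar>f z\<bar> powr Q) \<partial>lborel) (2 / Q)
      \<le> ennreal (K powr (2 / q) * s\<^sup>2)
        * (\<integral>\<^sup>+z\<in>half_space. ennreal (snd z powr (2 * A) * (grad_norm z)\<^sup>2) \<partial>lborel)"
      using Q s_def q_def _ \<theta>1 crit \<alpha>_def scaling K_def
      by (rule weighted_sobolev[where M = M]) (use M in \<open>auto simp: \<theta>_def\<close>)
    ultimately show ?thesis by (simp add: weighted_power_integral_def C_def)
  qed
  show ?thesis
  proof (intro exI[of _ C] conjI ballI impI)
    show "0 < C" by fact
  next
    fix f :: "(real ^ 'n) \<times> real \<Rightarrow> real"
    assume "f \<in> C0_infinity half_space"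
    then show "ennreal_powr (weighted_power_integral (B * Q) Q f) (2 / Q)
      \<le> ennreal C * weighted_energy (2 * A) f"
      by (rule main) auto
  next
    fix f :: "(real ^ 'n) \<times> real \<Rightarrow> real"
    assume "f \<in> C0_infinity UNIV" and "B * Q + 2 * A > 0 \<or> A = 0 \<and> B = 0"
    then show "ennreal_powr (weighted_power_integral (B * Q) Q f) (2 / Q)
      \<le> ennreal C * weighted_energy (2 * A) f"
      by (intro main[of f UNIV]) (auto simp: \<alpha>_def)
  qed
qed

end
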